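(* Let $\mathfrak g$ be a non-compact simple real Lie algebra with restricted root system $\Sigma=\Sigma(\mathfrak g,\mathfrak a)$, and let $\Omega$, $\partial_e\Omega$, $\alpha_1,\dots,\alpha_n$, $\omega_i$, $k_i$, $D^*$ be as in the context. Then for every $1\le i\le n$ the following statements are equivalent: (i) $\omega_i/k_i\in\partial_e\Omega$, i.e. $\omega_i/k_i$ is an extreme point of the compact convex polyhedron $\overline\Omega$; (ii) the graph $D^*-\{\alpha_i\}$, obtained from the affine Dynkin diagram $D^*$ by deleting the node $\alpha_i$, is connected.
   Context: $\mathfrak g=\mathfrak k\oplus\mathfrak p$ is a Cartan decomposition, $\mathfrak a\subset\mathfrak p$ is maximal abelian, $\Sigma\subset\mathfrak a^*$ is the (possibly non-reduced) irreducible restricted root system. $\Omega=\{Y\in\mathfrak a : |\alpha(Y)|<1\ \forall\alpha\in\Sigma\}$ and $\partial_e\Omega$ is the finite set of extreme points of $\overline\Omega$. $\Sigma^l=\{\alpha\in\Sigma: 2\alpha\notin\Sigma\}$ is the reduced irreducible subsystem of unmultipliable roots; $\Pi=\{\alpha_1,\dots,\alpha_n\}$ is a basis of $\Sigma^l$; $\beta=k_1\alpha_1+\dots+k_n\alpha_n$ is the highest root of $\Sigma^l$ with respect to $\Pi$ (so $k_i\in\mathbb Z_{>0}$); $\omega_i\in\mathfrak a$ is defined by $\alpha_j(\omega_i)=\delta_{ij}$. $D$ is the Dynkin diagram of $\Pi$, and $D^*$ is its affine extension, i.e. the Coxeter/Dynkin diagram of the affine Weyl group $W^{\rm aff}=W\ltimes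 \mathrm{span}_{\mathbb Z}\Sigma^\vee$, with nodes the affine simple roots $\alpha_0=1-\beta,\alpha_1,\dots,\alpha_n$. *)

theory Defs
  imports "HOL-Analysis.Analysis" "Graph_Theory.Graph_Theory"
begin

text \<open>
  A finite-dimensional real Lie algebra is a bracket on a Euclidean space. The inner product of the
  type is auxiliary: it only serves to write traces (which do not depend on the basis) and to
  provide the usual topology of a finite-dimensional space.
\<close>

locale lie_algebra =
  fixes br :: "'g::euclidean_space \<Rightarrow> 'g \<Rightarrow> 'g"
  assumes bilinear_br: "bilinear br"
    and br_self: "br x x = 0"
    and jacobi: "br x (br y z) + br y (br z x) + br z (br x y) = 0"

definition lie_ideal :: "('g::euclidean_space \<Rightarrow> 'g \<Rightarrow> 'g) \<Rightarrow> 'g set \<Rightarrow> bool" where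
  "lie_ideal br I \<longleftrightarrow> subspace I \<and> (\<forall>x. \<forall>y\<in>I. br x y \<in> I)"

locale simple_lie_algebra = lie_algebra +
  assumes non_abelian: "\<exists>x y. br x y \<noteq> 0"
    and ideals_trivial: "lie_ideal br I \<Longrightarrow> I = {0} \<or> I = UNIV"

definition linear_trace :: "('g::euclidean_space \<Rightarrow> 'g) \<Rightarrow> real" where
  "linear_trace f = (\<Sum>b\<in>Basis. f b \<bullet> b)"

definition killing_form :: "('g::euclidean_space \<Rightarrow> 'g \<Rightarrow> 'g) \<Rightarrow> 'g \<Rightarrow> 'g \<Rightarrow> real" where
  "killing_form br x y = linear_trace (br x \<circ> br y)"

text \<open>Compactness in the sense of semisimple Lie algebras: negative definite Killing form.\<close>

definition compact_lie_algebra :: "('g::euclidean_space \<Rightarrow> 'g \<Rightarrow> 'g) \<Rightarrow> bool" where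
  "compact_lie_algebra br \<longleftrightarrow> (\<forall>x. x \<noteq> 0 \<longrightarrow> killing_form br x x < 0)"

definition cartan_decomposition ::
    "('g::euclidean_space \<Rightarrow> 'g \<Rightarrow> 'g) \<Rightarrow> 'g set \<Rightarrow> 'g set \<Rightarrow> bool" where
  "cartan_decomposition br \<kk> \<pp> \<longleftrightarrow>
     subspace \<kk> \<and> subspace \<pp> \<and> \<kk> \<inter> \<pp> = {0} \<and> (\<forall>z. \<exists>x\<in>\<kk>. \<exists>y\<in>\<pp>. z = x + y) \<and>
     (\<forall>x\<in>\<kk>. \<forall>y\<in>\<kk>. br x y \<in> \<kk>) \<and> (\<forall>x\<in>\<kk>. \<forall>y\<in>\<pp>. br x y \<in> \<pp>) \<and> (\<forall>x\<in>\<pp>. \<forall>y\<in>\<pp>. br x y \<in> \<kk>) \<and>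
     (\<forall>x\<in>\<kk>. x \<noteq> 0 \<longrightarrow> killing_form br x x < 0) \<and> (\<forall>y\<in>\<pp>. y \<noteq> 0 \<longrightarrow> killing_form br y y > 0)"

definition abelian_subspace :: "('g::euclidean_space \<Rightarrow> 'g \<Rightarrow> 'g) \<Rightarrow> 'g set \<Rightarrow> bool" where
  "abelian_subspace br V \<longleftrightarrow> subspace V \<and> (\<forall>x\<in>V. \<forall>y\<in>V. br x y = 0)"

definition maximal_abelian_in ::
    "('g::euclidean_space \<Rightarrow> 'g \<Rightarrow> 'g) \<Rightarrow> 'g set \<Rightarrow> 'g set \<Rightarrow> bool" where
  "maximal_abelian_in br \<pp> \<aa> \<longleftrightarrow> abelian_subspace br \<aa> \<and> \<aa> \<subseteq> \<pp> \<and>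
     (\<forall>V. abelian_subspace br V \<and> V \<subseteq> \<pp> \<and> \<aa> \<subseteq> V \<longrightarrow> V = \<aa>)"

text \<open>
  Linear functionals on the subspace \<open>\<aa>\<close> are represented by their extension by \<open>0\<close> outside \<open>\<aa>\<close>,
  so that equality of functionals is equality of functions and the vector space operations
  are pointwise.
\<close>

definition dual_of :: "'g::euclidean_space set \<Rightarrow> ('g \<Rightarrow> real) set" where
  "dual_of \<aa> = {l. (\<forall>x\<in>\<aa>. \<forall>y\<in>\<aa>. l (x + y) = l x + l y) \<and> (\<forall>c. \<forall>x\<in>\<aa>. l (c *\<^sub>R x) = c * l x) \<and>
     (\<forall>x. x \<notin> \<aa> \<longrightarrow> l x = 0)}"

definition restricted_root_space ::
    "('g::euclidean_space \<Rightarrow> 'g \<Rightarrow> 'g) \<Rightarrow> 'g set \<Rightarrow> ('g \<Rightarrow> real) \<Rightarrow> 'g set" where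
  "restricted_root_space br \<aa> \<alpha> = {X. \<forall>H\<in>\<aa>. br H X = \<alpha> H *\<^sub>R X}"

definition restricted_roots ::
    "('g::euclidean_space \<Rightarrow> 'g \<Rightarrow> 'g) \<Rightarrow> 'g set \<Rightarrow> ('g \<Rightarrow> real) set" where
  "restricted_roots br \<aa> = {\<alpha> \<in> dual_of \<aa>. \<alpha> \<noteq> (\<lambda>_. 0) \<and> restricted_root_space br \<aa> \<alpha> \<noteq> {0}}"

definition unmultipliable_roots :: "('g \<Rightarrow> real) set \<Rightarrow> ('g \<Rightarrow> real) set" where
  "unmultipliable_roots R = {\<alpha> \<in> R. (\<lambda>Y. 2 * \<alpha> Y) \<notin> R}"

definition Omega :: "('g::euclidean_space \<Rightarrow> 'g \<Rightarrow> 'g) \<Rightarrow> 'g set \<Rightarrow> 'g set" where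
  "Omega br \<aa> = {Y \<in> \<aa>. \<forall>\<alpha>\<in>restricted_roots br \<aa>. \<bar>\<alpha> Y\<bar> < 1}"

definition extreme_boundary :: "'g::euclidean_space set \<Rightarrow> 'g set" where
  "extreme_boundary S = {x. x extreme_point_of (closure S)}"

definition root_basis ::
    "'g::euclidean_space set \<Rightarrow> ('g \<Rightarrow> real) set \<Rightarrow> nat \<Rightarrow> (nat \<Rightarrow> 'g \<Rightarrow> real) \<Rightarrow> bool" where
  "root_basis \<aa> R n \<alpha> \<longleftrightarrow>
     (\<forall>i\<in>{1..n}. \<alpha> i \<in> R) \<and>
     (\<forall>c. (\<forall>Y. (\<Sum>i=1..n. c i * \<alpha> i Y) = 0) \<longrightarrow> (\<forall>i\<in>{1..n}. c i = 0)) \<and>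
     (\<forall>l\<in>dual_of \<aa>. \<exists>c. \<forall>Y. l Y = (\<Sum>i=1..n. c i * \<alpha> i Y)) \<and>
     (\<forall>\<gamma>\<in>R. \<exists>m :: nat \<Rightarrow> int. (\<forall>Y. \<gamma> Y = (\<Sum>i=1..n. of_int (m i) * \<alpha> i Y)) \<and>
        ((\<forall>i\<in>{1..n}. m i \<ge> 0) \<or> (\<forall>i\<in>{1..n}. m i \<le> 0)))"

definition highest_root ::
    "('g \<Rightarrow> real) set \<Rightarrow> nat \<Rightarrow> (nat \<Rightarrow> 'g \<Rightarrow> real) \<Rightarrow> ('g \<Rightarrow> real) \<Rightarrow> bool" where
  "highest_root R n \<alpha> \<beta> \<longleftrightarrow> \<beta> \<in> R \<and>
     (\<forall>\<gamma>\<in>R. \<exists>m :: nat \<Rightarrow> nat. \<forall>Y. \<beta> Y - \<gamma> Y = (\<Sum>i=1..n. of_nat (m i) * \<alpha> i Y))"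

text \<open>
  The inner product on the dual of \<open>\<aa>\<close> is transported from the Killing form, which is positive
  definite on \<open>\<aa>\<close>.
\<close>

definition killing_dual_vector ::
    "('g::euclidean_space \<Rightarrow> 'g \<Rightarrow> 'g) \<Rightarrow> 'g set \<Rightarrow> ('g \<Rightarrow> real) \<Rightarrow> 'g" where
  "killing_dual_vector br \<aa> l = (THE H. H \<in> \<aa> \<and> (\<forall>Y\<in>\<aa>. killing_form br H Y = l Y))"

definition dual_inner ::
    "('g::euclidean_space \<Rightarrow> 'g \<Rightarrow> 'g) \<Rightarrow> 'g set \<Rightarrow> ('g \<Rightarrow> real) \<Rightarrow> ('g \<Rightarrow> real) \<Rightarrow> real" where
  "dual_inner br \<aa> l \<mu> = killing_form br (killing_dual_vector br \<aa> l) (killing_dual_vector br \<aa> \<mu>)"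

definition cartan_number ::
    "('g::euclidean_space \<Rightarrow> 'g \<Rightarrow> 'g) \<Rightarrow> 'g set \<Rightarrow> ('g \<Rightarrow> real) \<Rightarrow> ('g \<Rightarrow> real) \<Rightarrow> real" where
  "cartan_number br \<aa> l \<mu> = 2 * dual_inner br \<aa> l \<mu> / dual_inner br \<aa> \<mu> \<mu>"

text \<open>Affine roots are affine functions on \<open>\<aa>\<close>; the bonds between them are those of their linear parts.\<close>

definition linear_part :: "('g::euclidean_space \<Rightarrow> real) \<Rightarrow> 'g \<Rightarrow> real" where
  "linear_part f = (\<lambda>Y. f Y - f 0)"

definition bond_number ::
    "('g::euclidean_space \<Rightarrow> 'g \<Rightarrow> 'g) \<Rightarrow> 'g set \<Rightarrow> ('g \<Rightarrow> real) \<Rightarrow> ('g \<Rightarrow> real) \<Rightarrow> real" where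
  "bond_number br \<aa> f g = cartan_number br \<aa> (linear_part f) (linear_part g) *
     cartan_number br \<aa> (linear_part g) (linear_part f)"

definition affine_simple_roots ::
    "nat \<Rightarrow> (nat \<Rightarrow> 'g \<Rightarrow> real) \<Rightarrow> ('g \<Rightarrow> real) \<Rightarrow> ('g \<Rightarrow> real) set" where
  "affine_simple_roots n \<alpha> \<beta> = insert (\<lambda>Y. 1 - \<beta> Y) (\<alpha> ` {1..n})"

text \<open>
  Underlying graph of the affine Dynkin diagram, as a symmetric digraph: two distinct nodes are
  adjacent iff they are joined by at least one bond (the bond number is \<open>4\<close> for the two nodes
  in rank one). Multiplicities and arrows are not recorded.
\<close>

definition affine_dynkin_diagram ::
    "('g::euclidean_space \<Rightarrow> 'g \<Rightarrow> 'g) \<Rightarrow> 'g set \<Rightarrow> nat \<Rightarrow> (nat \<Rightarrow> 'g \<Rightarrow> real) \<Rightarrow> ('g \<Rightarrow> real) \<Rightarrow>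
      ('g \<Rightarrow> real) pair_pre_digraph" where
  "affine_dynkin_diagram br \<aa> n \<alpha> \<beta> =
     \<lparr>pverts = affine_simple_roots n \<alpha> \<beta>,
      parcs = {(f, g). f \<in> affine_simple_roots n \<alpha> \<beta> \<and> g \<in> affine_simple_roots n \<alpha> \<beta> \<and>
                 f \<noteq> g \<and> bond_number br \<aa> f g \<noteq> 0}\<rparr>"

end

theory Submission
  imports Defs
begin

text \<open>
  A point \<open>\<omega> i / k i\<close> is extreme iff the active roots, those of \<open>\<Sigma>l\<close> whose \<open>\<alpha> i\<close>-coefficient is \<open>k i\<close>,
  have trivial common kernel. The active roots are permuted by the reflections in \<open>\<alpha> j\<close>, \<open>j \<noteq> i\<close>.
  If \<open>D\<^sup>* - {\<alpha> i}\<close> is connected, these reflections propagate vanishing on the common kernel from the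
  highest root \<open>\<beta>\<close> along the edges to all simple roots. If it is disconnected, a component not containing
  \<open>\<alpha> 0\<close> is orthogonal to \<open>\<beta>\<close> and to the other components, which forces every active root to have the same
  coefficients on it as \<open>\<beta>\<close>; then \<open>k i *\<^sub>R \<omega> j - k j *\<^sub>R \<omega> i\<close> is in the common kernel for every \<open>\<alpha> j\<close> in it.
  The only input from Lie theory is the invariance of the restricted roots under reflections, obtained from
  the \<open>sl(2)\<close>-triples spanned by root vectors and their images under the Cartan involution.
\<close>

section \<open>Killing form and root spaces\<close>

text \<open>Written in matrix entries over \<open>Basis\<close>, both traces are the same double sum
  with the two summations exchanged.\<close>

lemma linear_trace_comp_commute:
  fixes f g :: "'g::euclidean_space \<Rightarrow> 'g"
  assumes "linear f" "linear g"
  shows "linear_trace (f \<circ> g) = linear_trace (g \<circ> f)"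
proof -
  have expand: "f (g b) \<bullet> b = (\<Sum>c\<in>Basis. (g b \<bullet> c) * (f c \<bullet> b))" if "linear f" for f g :: "'g \<Rightarrow> 'g" and b
  proof -
    have "f (g b) = f (\<Sum>c\<in>Basis. (g b \<bullet> c) *\<^sub>R c)"
      by (simp add: euclidean_representation)
    also have "\<dots> = (\<Sum>c\<in>Basis. (g b \<bullet> c) *\<^sub>R f c)"
      using that by (simp add: linear_sum linear_scale)
    finally show ?thesis
      by (simp add: inner_sum_left)
  qed
  have "linear_trace (f \<circ> g) = (\<Sum>b\<in>Basis. \<Sum>c\<in>Basis. (g b \<bullet> c) * (f c \<bullet> b))"
    by (simp add: linear_trace_def expand[OF assms(1)])
  also have "\<dots> = (\<Sum>c\<in>Basis. \<Sum>b\<in>Basis. (f c \<bullet> b) * (g b \<bullet> c))"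
    by (subst sum.swap) (simp add: mult.commute)
  also have "\<dots> = linear_trace (g \<circ> f)"
    by (simp add: linear_trace_def expand[OF assms(2)])
  finally show ?thesis .
qed

section \<open>Bracket identities and invariance of the Killing form\<close>

context lie_algebra
begin

lemmas br_simps = bilinear_ladd[OF bilinear_br] bilinear_radd[OF bilinear_br]
  bilinear_lmul[OF bilinear_br] bilinear_rmul[OF bilinear_br]
  bilinear_lneg[OF bilinear_br] bilinear_rneg[OF bilinear_br]
  bilinear_lsub[OF bilinear_br] bilinear_rsub[OF bilinear_br]
  bilinear_lzero[OF bilinear_br] bilinear_rzero[OF bilinear_br]

lemma linear_br: "linear (br x)"
  using bilinear_br by (simp add: bilinear_def)

lemma br_antisym: "br x y = - br y x"
proof -
  have "br (x + y) (x + y) = 0"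
    by (rule br_self)
  then have "br x y + br y x = 0"
    unfolding br_simps by (simp add: br_self add.commute)
  then show ?thesis
    using eq_neg_iff_add_eq_0 by blast
qed

text \<open>The Jacobi identity read as a Leibniz rule for \<open>br x\<close>; all weight
  computations use this form.\<close>

lemma br_derivation: "br x (br y z) = br (br x y) z + br y (br x z)"
proof -
  have "br x (br y z) = - br y (br z x) - br z (br x y)"
    using jacobi[of x y z] by (simp add: algebra_simps eq_neg_iff_add_eq_0)
  also have "br y (br z x) = - br y (br x z)"
    by (metis br_antisym br_simps(6))
  also have "br z (br x y) = - br (br x y) z"
    by (rule br_antisym)
  finally show ?thesis by simp
qed

lemma killing_add_left: "killing_form br (x + y) z = killing_form br x z + killing_form br y z"
  by (simp add: killing_form_def linear_trace_def br_simps inner_add_left sum.distrib)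

lemma killing_scale_left: "killing_form br (c *\<^sub>R x) z = c * killing_form br x z"
  by (simp add: killing_form_def linear_trace_def br_simps sum_distrib_left)

lemma killing_commute: "killing_form br x y = killing_form br y x"
  unfolding killing_form_def by (rule linear_trace_comp_commute) (rule linear_br)+

lemma killing_add_right: "killing_form br z (x + y) = killing_form br z x + killing_form br z y"
  by (metis killing_commute killing_add_left)

lemma killing_scale_right: "killing_form br z (c *\<^sub>R x) = c * killing_form br z x"
  by (metis killing_commute killing_scale_left)

lemma killing_diff_left: "killing_form br (x - y) z = killing_form br x z - killing_form br y z"
  using killing_add_left[of x "-1 *\<^sub>R y" z] killing_scale_left[of "-1" y z] by simp

lemma killing_diff_right: "killing_form br z (x - y) = killing_form br z x - killing_form br z y"
  by (metis killing_commute killing_diff_left)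

text \<open>Expand \<open>br (br x y)\<close> as a commutator. Cyclicity of the trace moves
  \<open>br y\<close> from the front of the second product to its end, and what remains is
  \<open>br x\<close> composed with the commutator of \<open>br y\<close> and
  \<open>br z\<close>.\<close>

lemma killing_invariant: "killing_form br (br x y) z = killing_form br x (br y z)"
proof -
  have lin: "linear (br x \<circ> br z)"
    by (intro linear_compose linear_br)
  have "br (br x y) (br z b) = br x (br y (br z b)) - br y (br x (br z b))" for b
    using br_derivation[of x y "br z b"] by simp
  then have "killing_form br (br x y) z =
      linear_trace (br x \<circ> br y \<circ> br z) - linear_trace (br y \<circ> (br x \<circ> br z))"
    by (simp add: killing_form_def linear_trace_def inner_diff_left sum_subtractf)
  also have "linear_trace (br y \<circ> (br x \<circ> br z)) = linear_trace (br x \<circ> br z \<circ> br y)"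
    by (rule linear_trace_comp_commute[OF linear_br lin])
  also have "linear_trace (br x \<circ> br y \<circ> br z) - linear_trace (br x \<circ> br z \<circ> br y) =
      killing_form br x (br y z)"
  proof -
    have "br x (br (br y z) b) = br x (br y (br z b)) - br x (br z (br y b))" for b
      using br_derivation[of y z b] by (simp add: br_simps)
    then show ?thesis
      by (simp add: killing_form_def linear_trace_def inner_diff_left sum_subtractf)
  qed
  finally show ?thesis .
qed

text \<open>
  The bound on the spectrum of \<open>ad H\<close> replaces finiteness of the set of restricted roots
  everywhere below.
\<close>

lemma restricted_root_bounded:
  obtains K where "K > 0"
    and "\<And>\<aa> \<gamma> X H. X \<in> restricted_root_space br \<aa> \<gamma> \<Longrightarrow> X \<noteq> 0 \<Longrightarrow> H \<in> \<aa> \<Longrightarrow> \<bar>\<gamma> H\<bar> \<le> K * norm H"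
proof -
  obtain K where K: "K > 0" "\<And>x y. norm (br x y) \<le> K * norm x * norm y"
    using bilinear_bounded_pos[OF bilinear_br] by (metis (no_types) mult.assoc)
  show thesis
  proof (rule that[OF K(1)])
    fix \<aa> \<gamma> X H assume X: "X \<in> restricted_root_space br \<aa> \<gamma>" "X \<noteq> 0" and H: "H \<in> \<aa>"
    have "\<bar>\<gamma> H\<bar> * norm X = norm (br H X)"
      using X(1) H by (simp add: restricted_root_space_def)
    also have "\<dots> \<le> K * norm H * norm X"
      by (rule K(2))
    finally show "\<bar>\<gamma> H\<bar> \<le> K * norm H"
      using X(2) by simp
  qed
qed

section \<open>Brackets of root spaces and nilpotency\<close>

lemma restricted_root_space_br:
  assumes "X \<in> restricted_root_space br \<aa> \<gamma>" "Y \<in> restricted_root_space br \<aa> \<delta>"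
  shows "br X Y \<in> restricted_root_space br \<aa> (\<lambda>H. \<gamma> H + \<delta> H)"
  using assms by (simp add: restricted_root_space_def br_derivation[of _ X Y] br_simps scaleR_add_left)

lemma restricted_root_space_scale:
  "X \<in> restricted_root_space br \<aa> \<gamma> \<Longrightarrow> c *\<^sub>R X \<in> restricted_root_space br \<aa> \<gamma>"
  by (simp add: restricted_root_space_def br_simps scaleR_left_commute)

lemma restricted_root_space_iterate:
  assumes "X \<in> restricted_root_space br \<aa> \<delta>" "v \<in> restricted_root_space br \<aa> \<gamma>"
  shows "(br X ^^ r) v \<in> restricted_root_space br \<aa> (\<lambda>H. \<gamma> H + real r * \<delta> H)"
proof (induction r)
  case 0
  then show ?case using assms by simp
next
  case (Suc r)
  have "(\<lambda>H. \<delta> H + (\<gamma> H + real r * \<delta> H)) = (\<lambda>H. \<gamma> H + real (Suc r) * \<delta> H)"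
    by (simp add: algebra_simps)
  then show ?case
    using restricted_root_space_br[OF assms(1) Suc] by simp
qed

text \<open>The iterates have weights \<gamma> + r \<delta>, whose values at \<open>H\<close> grow
  without bound in r, while nonzero vectors only occur for weights within the spectral bound of
  \<open>br H\<close>.\<close>

lemma restricted_root_space_nilpotent:
  assumes X: "X \<in> restricted_root_space br \<aa> \<delta>" and v: "v \<in> restricted_root_space br \<aa> \<gamma>"
    and H: "H \<in> \<aa>" "\<delta> H \<noteq> 0"
  shows "\<exists>r. (br X ^^ r) v = 0"
proof (rule ccontr)
  assume nz: "\<not> ?thesis"
  obtain K where K: "K > 0"
    "\<And>\<gamma> X H. X \<in> restricted_root_space br \<aa> \<gamma> \<Longrightarrow> X \<noteq> 0 \<Longrightarrow> H \<in> \<aa> \<Longrightarrow> \<bar>\<gamma> H\<bar> \<le> K * norm H"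
    using restricted_root_bounded by metis
  have bound: "real r * \<bar>\<delta> H\<bar> \<le> K * norm H + \<bar>\<gamma> H\<bar>" for r
  proof -
    have "\<bar>\<gamma> H + real r * \<delta> H\<bar> \<le> K * norm H"
      using K(2)[OF restricted_root_space_iterate[OF X v, of r] _ H(1)] nz by auto
    moreover have "\<bar>real r * \<delta> H\<bar> = real r * \<bar>\<delta> H\<bar>"
      by (simp add: abs_mult)
    ultimately show ?thesis by linarith
  qed
  obtain r where "K * norm H + \<bar>\<gamma> H\<bar> < real r * \<bar>\<delta> H\<bar>"
    using reals_Archimedean3[of "\<bar>\<delta> H\<bar>"] H(2) by auto
  then show False using bound[of r] by simp
qed

text \<open>
  A vector of nonnegative weight \<open>m\<close> under an \<open>sl(2)\<close>-triple is raised to a highest weight vector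
  of weight \<open>m + 2 r\<close>; the lowering string of that vector is long enough to reach weight \<open>-m\<close>.
\<close>

lemma sl2_reflected_weight:
  assumes E: "E \<in> restricted_root_space br \<aa> \<delta>"
    and F: "F \<in> restricted_root_space br \<aa> (\<lambda>H. - \<delta> H)"
    and h: "h \<in> \<aa>" "\<delta> h = 2" and EF: "br E F = h"
    and v: "v \<in> restricted_root_space br \<aa> \<gamma>" "v \<noteq> 0" and m: "\<gamma> h \<ge> 0"
  shows "\<exists>w. w \<noteq> 0 \<and> w \<in> restricted_root_space br \<aa> (\<lambda>H. \<gamma> H - \<gamma> h * \<delta> H)"
proof -
  obtain r where r: "(br E ^^ r) v \<noteq> 0" "(br E ^^ Suc r) v = 0"
  proof -
    obtain t where "(br E ^^ t) v = 0"
      using restricted_root_space_nilpotent[OF E v(1) h(1)] h by auto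
    then have "\<exists>r. (br E ^^ r) v \<noteq> 0 \<and> (br E ^^ Suc r) v = 0"
      using v(2) by (induction t) auto
    then show thesis using that by blast
  qed
  define u where "u = (br E ^^ r) v"
  have Eu: "br E u = 0" and u0: "u \<noteq> 0"
    using r by (simp_all add: u_def)
  have u: "u \<in> restricted_root_space br \<aa> (\<lambda>H. \<gamma> H + real r * \<delta> H)"
    unfolding u_def by (rule restricted_root_space_iterate[OF E v(1)])
  \<comment> \<open>\<open>N\<close> is the \<open>h\<close>-weight of \<open>u\<close>: each of the
    r applications of \<open>br E\<close> adds \<open>\<delta> h = 2\<close>.\<close>
  define N where "N = \<gamma> h + 2 * real r"
  have Fu: "(br F ^^ s) u \<in> restricted_root_space br \<aa> (\<lambda>H. \<gamma> H + (real r - real s) * \<delta> H)" for s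
  proof -
    have "(\<lambda>H. \<gamma> H + real r * \<delta> H + real s * - \<delta> H) = (\<lambda>H. \<gamma> H + (real r - real s) * \<delta> H)"
      by (simp add: algebra_simps)
    then show ?thesis
      using restricted_root_space_iterate[OF F u, of s] by metis
  qed
  have hFu: "br h ((br F ^^ s) u) = (N - 2 * real s) *\<^sub>R (br F ^^ s) u" for s
  proof -
    have "N - 2 * real s = \<gamma> h + (real r - real s) * \<delta> h"
      by (simp add: N_def h)
    then show ?thesis
      using Fu[of s] h(1) by (simp add: restricted_root_space_def)
  qed
  \<comment> \<open>The standard lowering relation of \<open>sl(2)\<close> for a highest weight
    vector. The scalar vanishes only at s = N: this keeps the lowering string nonzero up to N and,
    at its last nonzero vector, forces N to be a natural number.\<close>
  have EFu: "br E ((br F ^^ Suc s) u) = ((real s + 1) * (N - real s)) *\<^sub>R (br F ^^ s) u" for s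
  proof (induction s)
    case 0
    have "br E (br F u) = br h u + br F (br E u)"
      using br_derivation[of E F u] EF by simp
    then show ?case
      using hFu[of 0] by (simp add: Eu br_simps)
  next
    case (Suc s)
    let ?w = "(br F ^^ Suc s) u"
    have "br E (br F ?w) = br h ?w + br F (br E ?w)"
      using br_derivation[of E F ?w] EF by simp
    also have "br F (br E ?w) = ((real s + 1) * (N - real s)) *\<^sub>R ?w"
      by (simp only: Suc br_simps) simp
    also have "br h ?w = (N - 2 * real (Suc s)) *\<^sub>R ?w"
      by (rule hFu)
    also have "(N - 2 * real (Suc s)) *\<^sub>R ?w + ((real s + 1) * (N - real s)) *\<^sub>R ?w
       = ((real (Suc s) + 1) * (N - real (Suc s))) *\<^sub>R ?w"
      unfolding scaleR_add_left[symmetric] by (simp add: algebra_simps)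
    finally show ?case by simp
  qed
  have nz: "(br F ^^ s) u \<noteq> 0" if "real s \<le> N" for s
    using that
  proof (induction s)
    case 0
    then show ?case using u0 by simp
  next
    case (Suc s)
    then have "(br F ^^ s) u \<noteq> 0" "(real s + 1) * (N - real s) \<noteq> 0" by auto
    then have "br E ((br F ^^ Suc s) u) \<noteq> 0"
      unfolding EFu by simp
    then show ?case
      by (metis br_simps(10))
  qed
  obtain s where s: "(br F ^^ s) u \<noteq> 0" "(br F ^^ Suc s) u = 0"
  proof -
    obtain t where "(br F ^^ t) u = 0"
      using restricted_root_space_nilpotent[OF F u h(1)] h by auto
    then have "\<exists>s. (br F ^^ s) u \<noteq> 0 \<and> (br F ^^ Suc s) u = 0"
      using u0 by (induction t) auto
    then show thesis using that by blast
  qed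
  have "N = real s"
    using EFu[of s] s by (simp add: br_simps)
  \<comment> \<open>Lowering \<open>u\<close> by \<open>s - r\<close> steps undoes the r raisings
    and subtracts \<delta> a further \<open>\<gamma> h\<close> times. The assumption that
    \<open>\<gamma> h\<close> is nonnegative makes the subtraction of naturals exact.\<close>
  then have "\<gamma> h + real r = real (s - r)" "s \<ge> r"
    using m by (auto simp: N_def of_nat_diff)
  moreover have "real (s - r) \<le> N"
    using \<open>N = real s\<close> by simp
  moreover have "(\<lambda>H. \<gamma> H + (real r - real (s - r)) * \<delta> H) = (\<lambda>H. \<gamma> H - \<gamma> h * \<delta> H)"
  proof -
    have "real r - real (s - r) = - \<gamma> h"
      using calculation(1) by linarith
    then show ?thesis by simp
  qed
  ultimately show ?thesis
    using Fu[of "s - r"] nz[of "s - r"] by metis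
qed

end

section \<open>Reflections of restricted roots\<close>

locale restricted_root_setting = lie_algebra br
  for br :: "'g::euclidean_space \<Rightarrow> 'g \<Rightarrow> 'g" +
  fixes \<kk> \<pp> \<aa> :: "'g set"
  assumes cartan: "cartan_decomposition br \<kk> \<pp>"
    and max_abelian: "maximal_abelian_in br \<pp> \<aa>"
begin

abbreviation "\<Sigma> \<equiv> restricted_roots br \<aa>"
abbreviation "\<Sigma>l \<equiv> unmultipliable_roots \<Sigma>"
abbreviation "dual_vector \<equiv> killing_dual_vector br \<aa>"

text \<open>For a root \<delta>, the denominator is its squared length in the inner product
  transported from the Killing form.\<close>

definition coroot :: "('g \<Rightarrow> real) \<Rightarrow> 'g" where
  "coroot \<delta> = (2 / \<delta> (dual_vector \<delta>)) *\<^sub>R dual_vector \<delta>"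

definition reflect :: "('g \<Rightarrow> real) \<Rightarrow> ('g \<Rightarrow> real) \<Rightarrow> 'g \<Rightarrow> real" where
  "reflect \<delta> \<gamma> = (\<lambda>Y. \<gamma> Y - \<gamma> (coroot \<delta>) * \<delta> Y)"

section \<open>The maximal abelian subspace and opposite root vectors\<close>

lemma subspace_a: "subspace \<aa>"
  using max_abelian by (simp add: maximal_abelian_in_def abelian_subspace_def)

lemma a_subset_p: "\<aa> \<subseteq> \<pp>"
  using max_abelian by (simp add: maximal_abelian_in_def)

lemma br_a: "x \<in> \<aa> \<Longrightarrow> y \<in> \<aa> \<Longrightarrow> br x y = 0"
  using max_abelian by (simp add: maximal_abelian_in_def abelian_subspace_def)

lemma killing_pos: "y \<in> \<aa> \<Longrightarrow> y \<noteq> 0 \<Longrightarrow> killing_form br y y > 0"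
  using cartan a_subset_p by (auto simp: cartan_decomposition_def)

text \<open>Adjoining the line through \<open>y\<close> to \<aa> gives an abelian subspace of \<pp>,
  so by maximality nothing is added.\<close>

lemma centralizer_in_p:
  assumes y: "y \<in> \<pp>" and comm: "\<And>H. H \<in> \<aa> \<Longrightarrow> br H y = 0"
  shows "y \<in> \<aa>"
proof -
  define V where "V = {h + c *\<^sub>R y |h c. h \<in> \<aa>}"
  have sp: "subspace \<pp>"
    using cartan by (simp add: cartan_decomposition_def)
  have V: "subspace V"
  proof (rule subspaceI)
    show "0 \<in> V"
      unfolding V_def using subspace_0[OF subspace_a] by (auto intro!: exI[of _ 0])
  next
    fix u w assume "u \<in> V" "w \<in> V"
    then obtain h c h' c' where *: "u = h + c *\<^sub>R y" "w = h' + c' *\<^sub>R y" "h \<in> \<aa>" "h' \<in> \<aa>"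
      by (auto simp: V_def)
    show "u + w \<in> V"
      unfolding V_def using * subspace_add[OF subspace_a *(3,4)]
      by (auto intro!: exI[of _ "h + h'"] exI[of _ "c + c'"] simp: algebra_simps)
  next
    fix u r assume "u \<in> V"
    then obtain h c where *: "u = h + c *\<^sub>R y" "h \<in> \<aa>"
      by (auto simp: V_def)
    show "r *\<^sub>R u \<in> V"
      unfolding V_def using * subspace_scale[OF subspace_a *(2), of r]
      by (auto intro!: exI[of _ "r *\<^sub>R h"] exI[of _ "r * c"] simp: algebra_simps)
  qed
  have "br (h + c *\<^sub>R y) (h' + c' *\<^sub>R y) = 0" if "h \<in> \<aa>" "h' \<in> \<aa>" for h h' c c'
    using that comm[of h] comm[of h'] br_antisym[of y h'] by (simp add: br_simps br_a br_self)
  then have "\<forall>u\<in>V. \<forall>w\<in>V. br u w = 0"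
    by (auto simp: V_def)
  then have "abelian_subspace br V"
    using V by (simp add: abelian_subspace_def)
  moreover have "V \<subseteq> \<pp>"
    using a_subset_p y by (auto simp: V_def intro!: subspace_add[OF sp] subspace_scale[OF sp])
  moreover have "\<aa> \<subseteq> V"
    by (force simp: V_def intro: exI[of _ 0])
  ultimately have "V = \<aa>"
    using max_abelian by (simp add: maximal_abelian_in_def)
  moreover have "y \<in> V"
    unfolding V_def using subspace_0[OF subspace_a] by (force intro: exI[of _ 0] exI[of _ 1])
  ultimately show ?thesis by simp
qed

text \<open>The second vector is a multiple of the image of the first under the Cartan involution.\<close>

lemma root_vector_pair:
  assumes "\<gamma> \<in> \<Sigma>"
  obtains X Z where "X \<noteq> 0" "X \<in> restricted_root_space br \<aa> \<gamma>"
    "Z \<noteq> 0" "Z \<in> restricted_root_space br \<aa> (\<lambda>H. - \<gamma> H)"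
    "br X Z \<in> \<aa>" "\<And>Y. Y \<in> \<aa> \<Longrightarrow> killing_form br (br X Z) Y = \<gamma> Y"
proof -
  have "0 \<in> restricted_root_space br \<aa> \<gamma>"
    by (simp add: restricted_root_space_def br_simps)
  then obtain X where X: "X \<noteq> 0" "X \<in> restricted_root_space br \<aa> \<gamma>"
    using assms by (auto simp: restricted_roots_def)
  obtain x y where xy: "x \<in> \<kk>" "y \<in> \<pp>" "X = x + y"
  proof -
    have "\<exists>x\<in>\<kk>. \<exists>y\<in>\<pp>. X = x + y"
      using cartan by (simp add: cartan_decomposition_def)
    then show thesis using that by blast
  qed
  have sub: "subspace \<kk>" "subspace \<pp>" "\<kk> \<inter> \<pp> = {0}"
    and kp: "\<And>x y. x \<in> \<kk> \<Longrightarrow> y \<in> \<pp> \<Longrightarrow> br x y \<in> \<pp>"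
    and pp: "\<And>x y. x \<in> \<pp> \<Longrightarrow> y \<in> \<pp> \<Longrightarrow> br x y \<in> \<kk>"
    using cartan by (auto simp: cartan_decomposition_def)
  \<comment> \<open>Since \<open>H\<close> lies in \<pp>, \<open>br H\<close> exchanges \<kk> and
    \<pp>; compare the two components of \<open>br H X = \<gamma> H *\<^sub>R X\<close>.\<close>
  have H: "br H x = \<gamma> H *\<^sub>R y" "br H y = \<gamma> H *\<^sub>R x" if "H \<in> \<aa>" for H
  proof -
    have Hp: "H \<in> \<pp>" using that a_subset_p by auto
    have "br H x \<in> \<pp>"
      using kp[OF xy(1) Hp] br_antisym[of H x] subspace_neg[OF sub(2)] by simp
    then have 1: "br H x - \<gamma> H *\<^sub>R y \<in> \<pp>"
      using subspace_diff[OF sub(2)] subspace_scale[OF sub(2) xy(2)] by blast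
    have 2: "\<gamma> H *\<^sub>R x - br H y \<in> \<kk>"
      using subspace_diff[OF sub(1)] subspace_scale[OF sub(1) xy(1)] pp[OF Hp xy(2)] by blast
    have "br H X = \<gamma> H *\<^sub>R X"
      using X(2) that by (simp add: restricted_root_space_def)
    then have "br H x + br H y = \<gamma> H *\<^sub>R x + \<gamma> H *\<^sub>R y"
      by (simp add: xy(3) br_simps scaleR_add_right)
    then have eq: "br H x - \<gamma> H *\<^sub>R y = \<gamma> H *\<^sub>R x - br H y"
      by (simp add: algebra_simps)
    then have "br H x - \<gamma> H *\<^sub>R y \<in> \<kk> \<inter> \<pp>"
      using 1 2 by simp
    then have "br H x - \<gamma> H *\<^sub>R y = 0"
      using sub(3) by blast
    then show "br H x = \<gamma> H *\<^sub>R y" "br H y = \<gamma> H *\<^sub>R x"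
      using eq by auto
  qed
  \<comment> \<open>The image of \<open>X\<close> under the Cartan involution, which negates the
    weight.\<close>
  define T where "T = x - y"
  have T: "T \<in> restricted_root_space br \<aa> (\<lambda>H. - \<gamma> H)"
    by (simp add: restricted_root_space_def T_def br_simps H algebra_simps)
  define b where "b = killing_form br X T"
  have b: "b = killing_form br x x - killing_form br y y"
    by (simp add: b_def xy(3) T_def killing_add_left killing_diff_right killing_commute[of y x])
  have "x \<noteq> 0 \<or> y \<noteq> 0"
    using X(1) xy(3) by auto
  moreover have "x \<noteq> 0 \<Longrightarrow> killing_form br x x < 0" "y \<noteq> 0 \<Longrightarrow> killing_form br y y > 0"
    using cartan xy by (auto simp: cartan_decomposition_def)
  moreover have "killing_form br 0 0 = 0"
    using killing_scale_left[of 0 0 0] by simp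
  \<comment> \<open>The form is negative on \<kk> and positive on \<pp>, so both terms of
    \<open>b\<close> push it below zero and one of them is nonzero.\<close>
  ultimately have "b < 0"
    unfolding b by (cases "x = 0"; cases "y = 0") auto
  have XT: "br X T = - 2 *\<^sub>R br x y"
    using br_antisym[of y x] by (simp add: xy(3) T_def br_simps br_self scaleR_2)
  have XTa: "br X T \<in> \<aa>"
  proof (rule centralizer_in_p)
    show "br X T \<in> \<pp>"
      unfolding XT using kp[OF xy(1,2)] subspace_scale[OF sub(2)] by blast
    show "br H (br X T) = 0" if "H \<in> \<aa>" for H
      using restricted_root_space_br[OF X(2) T] that by (simp add: restricted_root_space_def)
  qed
  have XTk: "killing_form br (br X T) Y = b * \<gamma> Y" if "Y \<in> \<aa>" for Y
  proof -
    have "br T Y = \<gamma> Y *\<^sub>R T"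
      using T that br_antisym[of T Y] by (simp add: restricted_root_space_def)
    then show ?thesis
      by (simp add: killing_invariant killing_scale_right b_def)
  qed
  \<comment> \<open>This scaling makes \<open>br X Z\<close> the Killing dual vector of
    \<gamma>.\<close>
  define Z where "Z = (1 / b) *\<^sub>R T"
  have XZ: "br X Z = (1 / b) *\<^sub>R br X T"
    by (simp add: Z_def br_simps)
  show thesis
  proof (rule that[of X Z])
    show "X \<noteq> 0" "X \<in> restricted_root_space br \<aa> \<gamma>" by fact+
    have "T \<noteq> 0"
      using \<open>b < 0\<close> killing_scale_right[of X 0 0] by (auto simp: b_def)
    then show "Z \<noteq> 0"
      using \<open>b < 0\<close> by (simp add: Z_def)
    show "Z \<in> restricted_root_space br \<aa> (\<lambda>H. - \<gamma> H)"
      unfolding Z_def by (rule restricted_root_space_scale[OF T])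
    show "br X Z \<in> \<aa>"
      unfolding XZ by (rule subspace_scale[OF subspace_a XTa])
    show "killing_form br (br X Z) Y = \<gamma> Y" if "Y \<in> \<aa>" for Y
      using \<open>b < 0\<close> XTk[OF that] by (simp add: XZ killing_scale_left)
  qed
qed

section \<open>Restricted roots as linear functionals\<close>

lemma root_add: "\<gamma> \<in> \<Sigma> \<Longrightarrow> x \<in> \<aa> \<Longrightarrow> y \<in> \<aa> \<Longrightarrow> \<gamma> (x + y) = \<gamma> x + \<gamma> y"
  by (simp add: restricted_roots_def dual_of_def)

lemma root_scale: "\<gamma> \<in> \<Sigma> \<Longrightarrow> x \<in> \<aa> \<Longrightarrow> \<gamma> (c *\<^sub>R x) = c * \<gamma> x"
  by (simp add: restricted_roots_def dual_of_def)

lemma root_minus: "\<gamma> \<in> \<Sigma> \<Longrightarrow> x \<in> \<aa> \<Longrightarrow> \<gamma> (- x) = - \<gamma> x"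
  using root_scale[of \<gamma> x "-1"] by simp

lemma root_diff: "\<gamma> \<in> \<Sigma> \<Longrightarrow> x \<in> \<aa> \<Longrightarrow> y \<in> \<aa> \<Longrightarrow> \<gamma> (x - y) = \<gamma> x - \<gamma> y"
  using root_add[of \<gamma> x "-y"] root_minus[of \<gamma> y] subspace_neg[OF subspace_a] by simp

lemma root_zero: "\<gamma> \<in> \<Sigma> \<Longrightarrow> \<gamma> 0 = 0"
  using root_scale[of \<gamma> 0 0] subspace_0[OF subspace_a] by simp

lemma root_nonzero: "\<gamma> \<in> \<Sigma> \<Longrightarrow> \<exists>x\<in>\<aa>. \<gamma> x \<noteq> 0"
  by (fastforce simp: restricted_roots_def dual_of_def)

lemma root_bounded:
  obtains K where "K > 0" and "\<And>\<gamma> H. \<gamma> \<in> \<Sigma> \<Longrightarrow> H \<in> \<aa> \<Longrightarrow> \<bar>\<gamma> H\<bar> \<le> K * norm H"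
proof -
  obtain K where K: "K > 0"
    "\<And>\<gamma> X H. X \<in> restricted_root_space br \<aa> \<gamma> \<Longrightarrow> X \<noteq> 0 \<Longrightarrow> H \<in> \<aa> \<Longrightarrow> \<bar>\<gamma> H\<bar> \<le> K * norm H"
    using restricted_root_bounded by metis
  show thesis
  proof (rule that[OF K(1)])
    fix \<gamma> H assume "\<gamma> \<in> \<Sigma>" and H: "H \<in> \<aa>"
    then obtain X where "X \<noteq> 0" "X \<in> restricted_root_space br \<aa> \<gamma>"
      using root_vector_pair by blast
    then show "\<bar>\<gamma> H\<bar> \<le> K * norm H"
      using K(2) H by blast
  qed
qed

lemma root_uminus:
  assumes "\<gamma> \<in> \<Sigma>"
  shows "(\<lambda>Y. - \<gamma> Y) \<in> \<Sigma>"
proof -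
  obtain Z where Z: "Z \<noteq> 0" "Z \<in> restricted_root_space br \<aa> (\<lambda>H. - \<gamma> H)"
    by (rule root_vector_pair[OF assms]) blast
  have "(\<lambda>Y. - \<gamma> Y) \<in> dual_of \<aa>"
    using assms by (simp add: restricted_roots_def dual_of_def)
  moreover have "(\<lambda>Y. - \<gamma> Y) \<noteq> (\<lambda>_. 0)"
    using root_nonzero[OF assms] by (metis neg_equal_0_iff_equal)
  ultimately show ?thesis
    using Z by (auto simp: restricted_roots_def)
qed

section \<open>Dual vectors, coroots and reflections\<close>

lemma dual_vector_eqI:
  assumes "H \<in> \<aa>" "\<And>Y. Y \<in> \<aa> \<Longrightarrow> killing_form br H Y = l Y"
  shows "dual_vector l = H"
  unfolding killing_dual_vector_def
proof (rule the_equality)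
  show "H \<in> \<aa> \<and> (\<forall>Y\<in>\<aa>. killing_form br H Y = l Y)"
    using assms by blast
  fix H' assume H': "H' \<in> \<aa> \<and> (\<forall>Y\<in>\<aa>. killing_form br H' Y = l Y)"
  \<comment> \<open>The difference lies in \<aa> and pairs to zero with itself, so positive
    definiteness kills it.\<close>
  then have d: "H' - H \<in> \<aa>"
    using assms subspace_diff[OF subspace_a] by blast
  then have "killing_form br (H' - H) (H' - H) = 0"
    unfolding killing_diff_left[of H' H] using H' assms by simp
  then show "H' = H"
    using killing_pos[OF d] by auto
qed

text \<open>Existence needs no general representation theorem: the bracket of opposite root vectors
  is the dual vector.\<close>

lemma dual_vector:
  assumes "\<gamma> \<in> \<Sigma>"
  shows "dual_vector \<gamma> \<in> \<aa>" "Y \<in> \<aa> \<Longrightarrow> killing_form br (dual_vector \<gamma>) Y = \<gamma> Y"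
proof -
  obtain X Z where XZ: "br X Z \<in> \<aa>" "\<And>Y. Y \<in> \<aa> \<Longrightarrow> killing_form br (br X Z) Y = \<gamma> Y"
    by (rule root_vector_pair[OF assms]) blast
  then have "dual_vector \<gamma> = br X Z"
    by (rule dual_vector_eqI)
  then show "dual_vector \<gamma> \<in> \<aa>" "Y \<in> \<aa> \<Longrightarrow> killing_form br (dual_vector \<gamma>) Y = \<gamma> Y"
    using XZ by simp_all
qed

text \<open>Both sides are the Killing product of the two dual vectors.\<close>

lemma root_dual_vector_commute:
  assumes "\<gamma> \<in> \<Sigma>" "\<delta> \<in> \<Sigma>"
  shows "\<gamma> (dual_vector \<delta>) = \<delta> (dual_vector \<gamma>)"
  using dual_vector(2)[OF assms(1) dual_vector(1)[OF assms(2)]]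
    dual_vector(2)[OF assms(2) dual_vector(1)[OF assms(1)]]
    killing_commute[of "dual_vector \<gamma>" "dual_vector \<delta>"] by simp

lemma root_dual_vector_pos:
  assumes "\<gamma> \<in> \<Sigma>"
  shows "\<gamma> (dual_vector \<gamma>) > 0"
proof -
  obtain Y where "Y \<in> \<aa>" "\<gamma> Y \<noteq> 0"
    using root_nonzero[OF assms] by blast
  then have "dual_vector \<gamma> \<noteq> 0"
    using dual_vector(2)[OF assms, of Y] killing_scale_left[of 0 0 Y] by auto
  then show ?thesis
    using killing_pos[OF dual_vector(1)[OF assms]] dual_vector(2)[OF assms dual_vector(1)[OF assms]] by simp
qed

lemma cartan_number_nonzero_iff:
  assumes "\<gamma> \<in> \<Sigma>" "\<delta> \<in> \<Sigma>"
  shows "cartan_number br \<aa> \<gamma> \<delta> \<noteq> 0 \<longleftrightarrow> \<gamma> (dual_vector \<delta>) \<noteq> 0"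
  using root_dual_vector_pos[OF assms(2)] assms
  by (simp add: cartan_number_def dual_inner_def dual_vector)

lemma coroot_in_a: "\<delta> \<in> \<Sigma> \<Longrightarrow> coroot \<delta> \<in> \<aa>"
  unfolding coroot_def by (intro subspace_scale[OF subspace_a] dual_vector)

lemma root_coroot:
  assumes "\<gamma> \<in> \<Sigma>" "\<delta> \<in> \<Sigma>"
  shows "\<gamma> (coroot \<delta>) = 2 / \<delta> (dual_vector \<delta>) * \<gamma> (dual_vector \<delta>)"
  unfolding coroot_def using assms by (simp add: root_scale dual_vector)

lemma root_coroot_self: "\<delta> \<in> \<Sigma> \<Longrightarrow> \<delta> (coroot \<delta>) = 2"
  using root_dual_vector_pos[of \<delta>] by (simp add: root_coroot)

text \<open>Suitably scaled opposite root vectors of \<delta> form an \<open>sl(2)\<close>-triple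
  with the coroot; applied to a root vector of \<gamma>, it yields a nonzero vector of the reflected
  weight.\<close>

lemma reflect_root:
  assumes \<gamma>: "\<gamma> \<in> \<Sigma>" and \<delta>: "\<delta> \<in> \<Sigma>"
  shows "reflect \<delta> \<gamma> \<in> \<Sigma>"
proof -
  define h where "h = coroot \<delta>"
  have h: "h \<in> \<aa>" "\<delta> h = 2"
    unfolding h_def using coroot_in_a[OF \<delta>] root_coroot_self[OF \<delta>] by auto
  obtain X Z where X: "X \<noteq> 0" "X \<in> restricted_root_space br \<aa> \<delta>"
    and Z: "Z \<in> restricted_root_space br \<aa> (\<lambda>H. - \<delta> H)"
    and XZ: "br X Z \<in> \<aa>" "\<And>Y. Y \<in> \<aa> \<Longrightarrow> killing_form br (br X Z) Y = \<delta> Y"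
    by (rule root_vector_pair[OF \<delta>]) blast
  define F where "F = (2 / \<delta> (dual_vector \<delta>)) *\<^sub>R Z"
  have F: "F \<in> restricted_root_space br \<aa> (\<lambda>H. - \<delta> H)"
    unfolding F_def by (rule restricted_root_space_scale[OF Z])
  have XF: "br X F = h"
    using dual_vector_eqI[OF XZ] by (simp add: F_def h_def coroot_def br_simps)
  obtain v where v: "v \<noteq> 0" "v \<in> restricted_root_space br \<aa> \<gamma>"
    by (rule root_vector_pair[OF \<gamma>]) blast
  have "\<exists>w. w \<noteq> 0 \<and> w \<in> restricted_root_space br \<aa> (\<lambda>H. \<gamma> H - \<gamma> h * \<delta> H)"
  proof (cases "\<gamma> h \<ge> 0")
    case True
    then show ?thesis
      using sl2_reflected_weight[OF X(2) F h XF v(2,1)] by blast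
  next
    \<comment> \<open>Exchanging \<open>X\<close> and \<open>F\<close> turns \<open>h\<close> into
      \<open>- h\<close>: the weight becomes positive and the two signs cancel in the reflected
      functional.\<close>
    case False
    have "X \<in> restricted_root_space br \<aa> (\<lambda>H. - (- \<delta> H))"
      using X by simp
    moreover have "- h \<in> \<aa>" "- \<delta> (- h) = 2" "br F X = - h" "\<gamma> (- h) \<ge> 0"
      using h False subspace_neg[OF subspace_a h(1)] XF br_antisym[of F X]
      by (simp_all add: root_minus[OF \<gamma>] root_minus[OF \<delta>])
    ultimately have "\<exists>w. w \<noteq> 0 \<and> w \<in> restricted_root_space br \<aa> (\<lambda>H. \<gamma> H - \<gamma> (- h) * - \<delta> H)"
      by (intro sl2_reflected_weight[OF F _ _ _ _ v(2,1)])
    then show ?thesis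
      using h by (simp add: root_minus[OF \<gamma>])
  qed
  then obtain w where w: "w \<noteq> 0" "w \<in> restricted_root_space br \<aa> (reflect \<delta> \<gamma>)"
    by (auto simp: reflect_def h_def)
  have "reflect \<delta> \<gamma> \<in> dual_of \<aa>"
    using \<gamma> \<delta> by (auto simp: restricted_roots_def dual_of_def reflect_def algebra_simps)
  moreover have "reflect \<delta> \<gamma> \<noteq> (\<lambda>_. 0)"
  proof
    \<comment> \<open>Reflection negates the value at \<open>h\<close>, so a zero reflection would
      give \<open>\<gamma> h = 0\<close> and thus fix \<gamma>, which is not zero.\<close>
    assume 0: "reflect \<delta> \<gamma> = (\<lambda>_. 0)"
    have "reflect \<delta> \<gamma> h = - \<gamma> h"
      using h by (simp add: reflect_def h_def)
    then have "\<gamma> h = 0" using 0 by simp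
    then have "reflect \<delta> \<gamma> = \<gamma>"
      by (simp add: reflect_def h_def)
    then show False
      using 0 root_nonzero[OF \<gamma>] by auto
  qed
  ultimately show ?thesis
    using w by (auto simp: restricted_roots_def)
qed

section \<open>Unmultipliable roots and the closed polyhedron\<close>

lemma unmultipliable_root: "\<gamma> \<in> \<Sigma>l \<Longrightarrow> \<gamma> \<in> \<Sigma>"
  by (simp add: unmultipliable_roots_def)

text \<open>A reflection is a linear involution: if twice the reflected root were a root, reflecting
  back would make \<open>2 * \<gamma>\<close> one.\<close>

lemma reflect_unmultipliable_root:
  assumes "\<gamma> \<in> \<Sigma>l" "\<delta> \<in> \<Sigma>l"
  shows "reflect \<delta> \<gamma> \<in> \<Sigma>l"
proof -
  have \<gamma>: "\<gamma> \<in> \<Sigma>" and \<delta>: "\<delta> \<in> \<Sigma>"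
    using assms by (simp_all add: unmultipliable_root)
  have "(\<lambda>Y. 2 * reflect \<delta> \<gamma> Y) \<notin> \<Sigma>"
  proof
    assume "(\<lambda>Y. 2 * reflect \<delta> \<gamma> Y) \<in> \<Sigma>"
    then have "reflect \<delta> (\<lambda>Y. 2 * reflect \<delta> \<gamma> Y) \<in> \<Sigma>"
      by (rule reflect_root[OF _ \<delta>])
    moreover have "reflect \<delta> (\<lambda>Y. 2 * reflect \<delta> \<gamma> Y) = (\<lambda>Y. 2 * \<gamma> Y)"
      by (simp add: reflect_def root_coroot_self[OF \<delta>] algebra_simps)
    ultimately show False
      using assms(1) by (simp add: unmultipliable_roots_def)
  qed
  then show ?thesis
    using reflect_root[OF \<gamma> \<delta>] by (simp add: unmultipliable_roots_def)
qed

lemma uminus_unmultipliable_root: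
  assumes "\<gamma> \<in> \<Sigma>l"
  shows "(\<lambda>Y. - \<gamma> Y) \<in> \<Sigma>l"
proof -
  have "reflect \<gamma> \<gamma> = (\<lambda>Y. - \<gamma> Y)"
    using root_coroot_self[OF unmultipliable_root[OF assms]] by (simp add: reflect_def)
  then show ?thesis
    using reflect_unmultipliable_root[OF assms assms] by simp
qed

text \<open>Otherwise all the multiples by powers of 2 would be roots, against the uniform bound.
  This reduces the inequalities of all roots to those of \<Sigma>l.\<close>

lemma power2_multiple_unmultipliable:
  assumes "\<gamma> \<in> \<Sigma>"
  shows "\<exists>m::nat. (\<lambda>Y. 2 ^ m * \<gamma> Y) \<in> \<Sigma>l"
proof (rule ccontr)
  assume no: "\<not> ?thesis"
  have all: "(\<lambda>Y. 2 ^ m * \<gamma> Y) \<in> \<Sigma>" for m :: nat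
  proof (induction m)
    case 0
    then show ?case using assms by simp
  next
    case (Suc m)
    then show ?case
      using no by (auto simp: unmultipliable_roots_def mult.assoc)
  qed
  obtain K where K: "\<And>\<gamma> H. \<gamma> \<in> \<Sigma> \<Longrightarrow> H \<in> \<aa> \<Longrightarrow> \<bar>\<gamma> H\<bar> \<le> K * norm H"
    using root_bounded by metis
  obtain H where H: "H \<in> \<aa>" "\<gamma> H \<noteq> 0"
    using root_nonzero[OF assms] by blast
  obtain m where "K * norm H / \<bar>\<gamma> H\<bar> < 2 ^ m"
    using real_arch_pow[of 2] by auto
  then have "K * norm H < 2 ^ m * \<bar>\<gamma> H\<bar>"
    using H by (simp add: divide_less_eq)
  then show False
    using K[OF all[of m] H(1)] by (simp add: abs_mult)
qed

lemma closure_Omega: "closure (Omega br \<aa>) = {Y \<in> \<aa>. \<forall>\<gamma>\<in>\<Sigma>l. \<bar>\<gamma> Y\<bar> \<le> 1}" (is "_ = ?S")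
proof
  \<comment> \<open>Extended by zero outside \<aa>, a root need not be continuous on the whole
    space; the Killing functional agreeing with it on \<aa> is.\<close>
  have eq: "?S = \<aa> \<inter> (\<Inter>\<gamma>\<in>\<Sigma>l. {Y. \<bar>killing_form br (dual_vector \<gamma>) Y\<bar> \<le> 1})"
    by (auto simp: dual_vector unmultipliable_root)
  have "linear (killing_form br H)" for H
    by (rule linearI) (simp_all add: killing_add_right killing_scale_right)
  then have "continuous_on UNIV (killing_form br H)" for H
    by (rule linear_continuous_on[OF linear_conv_bounded_linear[THEN iffD1]])
  then have "closed ?S"
    unfolding eq by (intro closed_Int closed_INT ballI closed_subspace[OF subspace_a]
      closed_Collect_le continuous_intros)
  moreover have "Omega br \<aa> \<subseteq> ?S"
    by (force simp: Omega_def dest: unmultipliable_root)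
  ultimately show "closure (Omega br \<aa>) \<subseteq> ?S"
    by (rule closure_minimal[rotated])
  show "?S \<subseteq> closure (Omega br \<aa>)"
  proof
    fix Y assume Y: "Y \<in> ?S"
    have le: "\<bar>\<gamma> Y\<bar> \<le> 1" if "\<gamma> \<in> \<Sigma>" for \<gamma>
    proof -
      obtain m :: nat where "(\<lambda>Y. 2 ^ m * \<gamma> Y) \<in> \<Sigma>l"
        using power2_multiple_unmultipliable[OF \<open>\<gamma> \<in> \<Sigma>\<close>] by blast
      then have "2 ^ m * \<bar>\<gamma> Y\<bar> \<le> 1"
        using Y by (auto simp: abs_mult)
      moreover have "1 * \<bar>\<gamma> Y\<bar> \<le> 2 ^ m * \<bar>\<gamma> Y\<bar>"
        by (rule mult_right_mono) auto
      ultimately show ?thesis by simp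
    qed
    \<comment> \<open>Shrinking \<open>Y\<close> towards the origin makes all inequalities strict,
      and the factors tend to 1.\<close>
    define y where "y = (\<lambda>m. (1 - inverse (real (Suc m))) *\<^sub>R Y)"
    have "y m \<in> Omega br \<aa>" for m
    proof -
      define t where "t = 1 - inverse (real (Suc m))"
      have t: "0 \<le> t" "t < 1"
        by (auto simp: t_def field_simps)
      have ym: "y m = t *\<^sub>R Y"
        by (simp only: y_def t_def)
      have "\<bar>\<gamma> (y m)\<bar> < 1" if "\<gamma> \<in> \<Sigma>" for \<gamma>
      proof -
        have "\<bar>\<gamma> (y m)\<bar> = t * \<bar>\<gamma> Y\<bar>"
          using Y that t by (simp add: ym root_scale abs_mult)
        also have "\<dots> \<le> t"
          using le[OF that] t(1) by (simp add: mult_left_le)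
        finally show ?thesis using t(2) by simp
      qed
      then show ?thesis
        using Y subspace_scale[OF subspace_a] by (auto simp: Omega_def ym)
    qed
    moreover have "y \<longlonglongrightarrow> (1 - 0) *\<^sub>R Y"
      unfolding y_def by (intro tendsto_intros LIMSEQ_inverse_real_of_nat)
    ultimately show "Y \<in> closure (Omega br \<aa>)"
      by (auto simp: closure_sequential)
  qed
qed

end

section \<open>Cuts of the diagram and active roots\<close>

text \<open>A set closed under adjacency and containing \<open>r\<close> contains all that is
  reachable from \<open>r\<close>; conversely, test the condition on the set of vertices reachable
  from \<open>r\<close>. Cuts are the form in which connectivity is compared with orthogonality of
  roots.\<close>

lemma connected_iff_no_cut:
  assumes "wf_digraph G" and r: "r \<in> verts G"
  shows "Digraph_Component.connected G \<longleftrightarrow>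
    (\<forall>C \<subseteq> verts G. r \<in> C \<and> (\<forall>e\<in>arcs G. tail G e \<in> C \<longleftrightarrow> head G e \<in> C) \<longrightarrow> C = verts G)"
    (is "_ \<longleftrightarrow> ?R")
proof
  let ?E = "(arcs_ends G)\<^sup>s"
  assume "Digraph_Component.connected G"
  then have reach: "(r, v) \<in> rtrancl_on (verts G) ?E" if "v \<in> verts G" for v
    using that r by (simp add: connected_conv)
  show ?R
  proof (intro allI impI)
    fix C assume C: "C \<subseteq> verts G" "r \<in> C \<and> (\<forall>e\<in>arcs G. tail G e \<in> C \<longleftrightarrow> head G e \<in> C)"
    have "v \<in> C" if "(r, v) \<in> rtrancl_on (verts G) ?E" for v
      using that
    proof (induction rule: rtrancl_on_induct)
      case base
      then show ?case using C by simp
    next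
      case (step y z)
      then show ?case using C by (auto simp: symcl_def arcs_ends_conv)
    qed
    then show "C = verts G"
      using reach C(1) by blast
  qed
next
  let ?E = "(arcs_ends G)\<^sup>s"
  assume R: ?R
  define C where "C = {v. (r, v) \<in> rtrancl_on (verts G) ?E}"
  have "C \<subseteq> verts G"
    unfolding C_def by (auto dest: in_rtrancl_on_in_F)
  moreover have "r \<in> C"
    using r by (simp add: C_def)
  moreover have "tail G e \<in> C \<longleftrightarrow> head G e \<in> C" if "e \<in> arcs G" for e
  proof -
    have "(tail G e, head G e) \<in> ?E" "(head G e, tail G e) \<in> ?E"
      using that by (auto simp: symcl_def arcs_ends_conv)
    moreover have "tail G e \<in> verts G" "head G e \<in> verts G"
      using that assms(1) by (auto simp: wf_digraph_def)
    ultimately show ?thesis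
      unfolding C_def by (auto intro: rtrancl_on_into_rtrancl_on)
  qed
  ultimately have "C = verts G"
    using R by blast
  then have reach: "(r, v) \<in> rtrancl_on (verts G) ?E" if "v \<in> verts G" for v
    using that by (auto simp: C_def)
  moreover have "sym (rtrancl_on (verts G) ?E)"
    by (rule rtrancl_on_sym) (auto simp: symcl_def sym_def)
  ultimately have "(u, v) \<in> rtrancl_on (verts G) ?E" if "u \<in> verts G" "v \<in> verts G" for u v
    using that by (meson rtrancl_on_trans symE)
  then show "Digraph_Component.connected G"
    using r by (auto simp: connected_conv)
qed

section \<open>Coefficients of roots in the simple basis\<close>

locale highest_root_setting = restricted_root_setting +
  fixes n :: nat and \<alpha> :: "nat \<Rightarrow> 'a \<Rightarrow> real" and \<beta> :: "'a \<Rightarrow> real" and k :: "nat \<Rightarrow> int" and \<omega> :: "nat \<Rightarrow> 'a"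
  assumes basis: "root_basis \<aa> \<Sigma>l n \<alpha>"
    and highest: "highest_root \<Sigma>l n \<alpha> \<beta>"
    and \<beta>_eq: "\<beta> Y = (\<Sum>i=1..n. of_int (k i) * \<alpha> i Y)"
    and \<omega>_in_a: "i \<in> {1..n} \<Longrightarrow> \<omega> i \<in> \<aa>"
    and \<alpha>_\<omega>: "i \<in> {1..n} \<Longrightarrow> j \<in> {1..n} \<Longrightarrow> \<alpha> j (\<omega> i) = (if i = j then 1 else 0)"
begin

lemma \<alpha>_unmultipliable: "j \<in> {1..n} \<Longrightarrow> \<alpha> j \<in> \<Sigma>l"
  using basis by (simp add: root_basis_def)

lemma \<alpha>_root: "j \<in> {1..n} \<Longrightarrow> \<alpha> j \<in> \<Sigma>"
  by (simp add: \<alpha>_unmultipliable unmultipliable_root)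

lemma \<beta>_unmultipliable: "\<beta> \<in> \<Sigma>l"
  using highest by (simp add: highest_root_def)

lemma \<beta>_root: "\<beta> \<in> \<Sigma>"
  using \<beta>_unmultipliable unmultipliable_root by blast

lemma sum_\<alpha>_\<omega>: "j \<in> {1..n} \<Longrightarrow> (\<Sum>i=1..n. c i * \<alpha> i (\<omega> j)) = c j"
proof -
  assume j: "j \<in> {1..n}"
  have "(\<Sum>i=1..n. c i * \<alpha> i (\<omega> j)) = (\<Sum>i=1..n. if i = j then c i else 0)"
    by (rule sum.cong) (use j in \<open>auto simp: \<alpha>_\<omega>\<close>)
  then show ?thesis
    using j by simp
qed

lemma \<beta>_\<omega>: "j \<in> {1..n} \<Longrightarrow> \<beta> (\<omega> j) = k j"
  unfolding \<beta>_eq by (rule sum_\<alpha>_\<omega>)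

lemma root_expand:
  assumes "\<gamma> \<in> \<Sigma>l"
  shows "\<gamma> Y = (\<Sum>i=1..n. \<gamma> (\<omega> i) * \<alpha> i Y)"
proof -
  obtain m :: "nat \<Rightarrow> int" where m: "\<And>Y. \<gamma> Y = (\<Sum>i=1..n. of_int (m i) * \<alpha> i Y)"
    using basis assms unfolding root_basis_def by meson
  then have "\<gamma> (\<omega> i) = of_int (m i)" if "i \<in> {1..n}" for i
    using sum_\<alpha>_\<omega>[OF that, of "\<lambda>i. of_int (m i)"] by simp
  then show ?thesis
    by (subst m) simp
qed

text \<open>Maximality of \<beta>, read at \<open>\<omega> j\<close>. Integrality of the defect
  later makes the descent terminate and separates inactive roots from the bound.\<close>

lemma coeff_defect:
  assumes "\<gamma> \<in> \<Sigma>l" "j \<in> {1..n}"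
  obtains d :: nat where "\<gamma> (\<omega> j) = of_int (k j) - real d"
proof -
  obtain m :: "nat \<Rightarrow> nat" where m: "\<And>Y. \<beta> Y - \<gamma> Y = (\<Sum>i=1..n. of_nat (m i) * \<alpha> i Y)"
    using highest assms(1) unfolding highest_root_def by meson
  have "\<beta> (\<omega> j) - \<gamma> (\<omega> j) = real (m j)"
    unfolding m by (rule sum_\<alpha>_\<omega>[OF assms(2)])
  then show thesis
    using that[of "m j"] \<beta>_\<omega>[OF assms(2)] by simp
qed

text \<open>The root \<open>\<alpha> j\<close> itself has coefficient 1 and lies below
  \<beta>.\<close>

lemma k_ge_1:
  assumes "j \<in> {1..n}"
  shows "k j \<ge> 1"
proof -
  obtain d :: nat where "\<alpha> j (\<omega> j) = of_int (k j) - real d"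
    using coeff_defect[OF \<alpha>_unmultipliable[OF assms] assms] by blast
  then have "real_of_int (k j) \<ge> 1"
    using assms by (simp add: \<alpha>_\<omega>)
  then show ?thesis by linarith
qed

text \<open>The simple roots span the dual, in particular the Killing functional of
  \<open>v\<close>; that functional then vanishes at \<open>v\<close>, against positive
  definiteness.\<close>

lemma separating:
  assumes v: "v \<in> \<aa>" and 0: "\<And>j. j \<in> {1..n} \<Longrightarrow> \<alpha> j v = 0"
  shows "v = 0"
proof -
  define l where "l = (\<lambda>Y. if Y \<in> \<aa> then killing_form br v Y else 0)"
  have "l \<in> dual_of \<aa>"
    using subspace_a by (simp add: dual_of_def l_def killing_add_right killing_scale_right subspace_def)
  then obtain c where "\<And>Y. l Y = (\<Sum>i=1..n. c i * \<alpha> i Y)"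
    using basis unfolding root_basis_def by meson
  then have "l v = 0"
    using 0 by simp
  then have "killing_form br v v = 0"
    using v by (simp add: l_def)
  then show ?thesis
    using killing_pos[OF v] by auto
qed

section \<open>Active roots and orthogonal blocks\<close>

definition active :: "nat \<Rightarrow> ('a \<Rightarrow> real) set" where
  "active i = {\<gamma> \<in> \<Sigma>l. \<gamma> (\<omega> i) = k i}"

text \<open>In diagram terms, a union of components of \<open>D\<^sup>* - {\<alpha> i}\<close>
  avoiding the affine node. The empty set always qualifies, so only nonempty blocks carry
  information.\<close>

definition orthogonal_block :: "nat \<Rightarrow> nat set \<Rightarrow> bool" where
  "orthogonal_block i J \<longleftrightarrow> J \<subseteq> {1..n} - {i} \<and>
     (\<forall>j\<in>J. \<beta> (dual_vector (\<alpha> j)) = 0 \<and> (\<forall>l\<in>{1..n} - {i} - J. \<alpha> l (dual_vector (\<alpha> j)) = 0))"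

lemma \<beta>_active: "i \<in> {1..n} \<Longrightarrow> \<beta> \<in> active i"
  by (simp add: active_def \<beta>_unmultipliable \<beta>_\<omega>)

text \<open>Reflecting in \<open>\<alpha> j\<close> changes only the coefficient of
  \<open>\<alpha> j\<close>.\<close>

lemma reflect_active:
  assumes "\<gamma> \<in> active i" "i \<in> {1..n}" "j \<in> {1..n}" "j \<noteq> i"
  shows "reflect (\<alpha> j) \<gamma> \<in> active i"
  using assms reflect_unmultipliable_root[OF _ \<alpha>_unmultipliable[of j]]
  by (auto simp: active_def reflect_def \<alpha>_\<omega>)

lemma vertex_value:
  assumes "\<gamma> \<in> \<Sigma>l" "i \<in> {1..n}"
  shows "\<gamma> ((1 / of_int (k i)) *\<^sub>R \<omega> i) = \<gamma> (\<omega> i) / of_int (k i)"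
  using root_scale[OF unmultipliable_root[OF assms(1)] \<omega>_in_a[OF assms(2)]] by simp

text \<open>Both \<gamma> and its negative lie below \<beta>.\<close>

lemma coeff_le:
  assumes "\<gamma> \<in> \<Sigma>l" "i \<in> {1..n}"
  shows "\<bar>\<gamma> (\<omega> i)\<bar> \<le> k i"
proof -
  obtain d :: nat where "\<gamma> (\<omega> i) = of_int (k i) - real d"
    by (rule coeff_defect[OF assms])
  moreover obtain e :: nat where "- \<gamma> (\<omega> i) = of_int (k i) - real e"
    by (rule coeff_defect[OF uminus_unmultipliable_root[OF assms(1)] assms(2)])
  ultimately show ?thesis by linarith
qed

lemma vertex_in_closure:
  assumes "i \<in> {1..n}"
  shows "(1 / of_int (k i)) *\<^sub>R \<omega> i \<in> closure (Omega br \<aa>)"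
  using assms k_ge_1[OF assms] coeff_le[OF _ assms] subspace_scale[OF subspace_a \<omega>_in_a[OF assms]]
  by (auto simp: closure_Omega vertex_value abs_divide divide_le_eq)

text \<open>
  The common kernel \<open>K\<close> of the active roots is stable under the reflections fixing the coefficient
  of \<open>\<alpha> i\<close>. Hence a simple root that does not vanish on \<open>K\<close> is orthogonal to every root vanishing on \<open>K\<close>,
  and these simple roots form an orthogonal block.
\<close>

lemma active_separating:
  assumes i: "i \<in> {1..n}" and no_block: "\<And>J. orthogonal_block i J \<Longrightarrow> J = {}"
    and v: "v \<in> \<aa>" "\<And>\<gamma>. \<gamma> \<in> active i \<Longrightarrow> \<gamma> v = 0"
  shows "v = 0"
proof (rule separating[OF v(1)])
  define K where "K = {v \<in> \<aa>. \<forall>\<gamma>\<in>active i. \<gamma> v = 0}"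
  define J where "J = {j \<in> {1..n} - {i}. \<exists>v\<in>K. \<alpha> j v \<noteq> 0}"
  have orth: "\<delta> (dual_vector (\<alpha> j)) = 0"
    if j: "j \<in> J" and \<delta>: "\<delta> \<in> \<Sigma>" "\<And>v. v \<in> K \<Longrightarrow> \<delta> v = 0" for \<delta> j
  proof -
    have jn: "j \<in> {1..n}" "j \<noteq> i"
      using j by (auto simp: J_def)
    obtain v where v: "v \<in> K" "\<alpha> j v \<noteq> 0"
      using j by (auto simp: J_def)
    have va: "v \<in> \<aa>" and ca: "\<alpha> j v *\<^sub>R coroot (\<alpha> j) \<in> \<aa>"
      using v(1) coroot_in_a[OF \<alpha>_root[OF jn(1)]] subspace_scale[OF subspace_a] by (auto simp: K_def)
    \<comment> \<open>The reflection in \<open>\<alpha> j\<close> acting on vectors. Since \<delta>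
      vanishes on \<open>v\<close> and on \<open>w\<close>, it vanishes on their difference, a
      nonzero multiple of the coroot.\<close>
    define w where "w = v - \<alpha> j v *\<^sub>R coroot (\<alpha> j)"
    have w: "\<gamma> w = \<gamma> v - \<alpha> j v * \<gamma> (coroot (\<alpha> j))" if "\<gamma> \<in> \<Sigma>" for \<gamma>
      using root_diff[OF that va ca] root_scale[OF that coroot_in_a[OF \<alpha>_root[OF jn(1)]]]
      by (simp add: w_def)
    have "\<gamma> w = 0" if "\<gamma> \<in> active i" for \<gamma>
    proof -
      have "\<gamma> \<in> \<Sigma>"
        using that by (simp add: active_def unmultipliable_root)
      then have "\<gamma> w = reflect (\<alpha> j) \<gamma> v"
        by (simp add: w reflect_def)
      then show ?thesis
        using reflect_active[OF that i jn] v(1) by (simp add: K_def)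
    qed
    then have "w \<in> K"
      using va ca subspace_diff[OF subspace_a] by (simp add: K_def w_def)
    then have "\<delta> (coroot (\<alpha> j)) = 0"
      using w[OF \<delta>(1)] \<delta>(2)[of w] \<delta>(2)[OF v(1)] v(2) by simp
    then show ?thesis
      using root_coroot[OF \<delta>(1) \<alpha>_root[OF jn(1)]] root_dual_vector_pos[OF \<alpha>_root[OF jn(1)]] by simp
  qed
  have "orthogonal_block i J"
    unfolding orthogonal_block_def
  proof (intro conjI ballI)
    show "J \<subseteq> {1..n} - {i}"
      by (auto simp: J_def)
    show "\<beta> (dual_vector (\<alpha> j)) = 0" if "j \<in> J" for j
      by (rule orth[OF that \<beta>_root]) (use \<beta>_active[OF i] in \<open>simp add: K_def\<close>)
    show "\<alpha> l (dual_vector (\<alpha> j)) = 0" if "j \<in> J" "l \<in> {1..n} - {i} - J" for j l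
      by (rule orth[OF that(1) \<alpha>_root]) (use that(2) in \<open>auto simp: J_def\<close>)
  qed
  then have "J = {}"
    by (rule no_block)
  have vK: "v \<in> K"
    using v by (simp add: K_def)
  have 0: "\<alpha> j v = 0" if "j \<in> {1..n}" "j \<noteq> i" for j
    using \<open>J = {}\<close> that vK by (auto simp: J_def)
  \<comment> \<open>Only \<open>\<alpha> i\<close> is left; \<beta> is active and involves it with
    the nonzero coefficient \<open>k i\<close>.\<close>
  have "0 = \<beta> v"
    using v(2)[OF \<beta>_active[OF i]] by simp
  also have "\<dots> = of_int (k i) * \<alpha> i v + (\<Sum>j\<in>{1..n} - {i}. of_int (k j) * \<alpha> j v)"
    unfolding \<beta>_eq using i by (simp add: sum.remove)
  also have "\<dots> = of_int (k i) * \<alpha> i v"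
    using 0 by simp
  finally have "\<alpha> i v = 0"
    using k_ge_1[OF i] by simp
  then show "\<alpha> j v = 0" if "j \<in> {1..n}" for j
    using 0 that by blast
qed

text \<open>An active root is 1 at the point and at most 1 at the ends of any segment of the
  polyhedron through its interior, so it is 1 at both ends. Their difference lies in the common
  kernel, which is trivial.\<close>

lemma vertex_extreme:
  assumes i: "i \<in> {1..n}" and no_block: "\<And>J. orthogonal_block i J \<Longrightarrow> J = {}"
  shows "(1 / of_int (k i)) *\<^sub>R \<omega> i \<in> extreme_boundary (Omega br \<aa>)"
proof -
  let ?x = "(1 / of_int (k i)) *\<^sub>R \<omega> i"
  have False if a: "a \<in> closure (Omega br \<aa>)" and b: "b \<in> closure (Omega br \<aa>)"
    and x: "?x \<in> open_segment a b" for a b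
  proof -
    obtain u where u: "0 < u" "u < 1" "?x = (1 - u) *\<^sub>R a + u *\<^sub>R b" and "a \<noteq> b"
      using x by (auto simp: in_segment)
    have ab: "a \<in> \<aa>" "b \<in> \<aa>"
      using a b by (simp_all add: closure_Omega)
    have "b - a = 0"
    proof (rule active_separating[OF i no_block])
      show "b - a \<in> \<aa>"
        using ab subspace_diff[OF subspace_a] by blast
      fix \<gamma> assume "\<gamma> \<in> active i"
      then have \<gamma>: "\<gamma> \<in> \<Sigma>l" "\<gamma> \<in> \<Sigma>" "\<gamma> (\<omega> i) = k i"
        by (simp_all add: active_def unmultipliable_root)
      have "1 = \<gamma> ?x"
        using vertex_value[OF \<gamma>(1) i] \<gamma>(3) k_ge_1[OF i] by simp
      also have "\<dots> = (1 - u) * \<gamma> a + u * \<gamma> b"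
        unfolding u(3) using ab subspace_scale[OF subspace_a]
        by (simp add: root_add[OF \<gamma>(2)] root_scale[OF \<gamma>(2)])
      finally have eq: "(1 - u) * (1 - \<gamma> a) + u * (1 - \<gamma> b) = 0"
        by (simp add: algebra_simps)
      have "\<bar>\<gamma> a\<bar> \<le> 1" "\<bar>\<gamma> b\<bar> \<le> 1"
        using a b \<gamma>(1) by (auto simp: closure_Omega)
      then have "(1 - u) * (1 - \<gamma> a) \<ge> 0" "u * (1 - \<gamma> b) \<ge> 0"
        using u by auto
      then have "(1 - u) * (1 - \<gamma> a) = 0" "u * (1 - \<gamma> b) = 0"
        using eq by linarith+
      then show "\<gamma> (b - a) = 0"
        using u ab by (simp add: root_diff[OF \<gamma>(2)])
    qed
    then show False
      using \<open>a \<noteq> b\<close> by simp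
  qed
  then show ?thesis
    using vertex_in_closure[OF i] by (auto simp: extreme_boundary_def extreme_point_of_def)
qed

section \<open>Nonempty blocks obstruct extremality\<close>

lemma active_dual_vector:
  fixes \<gamma> :: "'a \<Rightarrow> real"
  assumes i: "i \<in> {1..n}" and J: "orthogonal_block i J" and \<gamma>: "\<gamma> \<in> active i" and j: "j \<in> J"
  shows "\<gamma> (dual_vector (\<alpha> j)) = - (\<Sum>l\<in>J. (k l - \<gamma> (\<omega> l)) * \<alpha> l (dual_vector (\<alpha> j)))"
proof -
  let ?h = "dual_vector (\<alpha> j)"
  have Jn: "J \<subseteq> {1..n}"
    using J by (auto simp: orthogonal_block_def)
  have "\<beta> ?h - \<gamma> ?h = (\<Sum>l=1..n. (k l - \<gamma> (\<omega> l)) * \<alpha> l ?h)"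
    using root_expand[of \<gamma> ?h] \<gamma>
    by (simp add: active_def \<beta>_eq left_diff_distrib sum_subtractf)
  also have "\<dots> = (\<Sum>l\<in>J. (k l - \<gamma> (\<omega> l)) * \<alpha> l ?h)"
  proof (rule sum.mono_neutral_right)
    \<comment> \<open>At \<open>i\<close> the two coefficients agree because \<gamma> is active;
      every other simple root outside \<open>J\<close> is orthogonal to
      \<open>\<alpha> j\<close>.\<close>
    show "\<forall>l\<in>{1..n} - J. (k l - \<gamma> (\<omega> l)) * \<alpha> l ?h = 0"
      using J j \<gamma> by (fastforce simp: orthogonal_block_def active_def)
  qed (use Jn in auto)
  finally show ?thesis
    using J j by (simp add: orthogonal_block_def)
qed

text \<open>
  Descent: an active root differing from \<open>\<beta>\<close> on the block pairs negatively with some simple root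
  of the block, and reflecting in it moves the root closer to \<open>\<beta>\<close>. The last root reached is orthogonal
  to the block, so no reflection can have led to it.
\<close>

lemma active_block_coeff:
  fixes \<gamma> :: "'a \<Rightarrow> real"
  assumes i: "i \<in> {1..n}" and J: "orthogonal_block i J"
  shows "\<gamma> \<in> active i \<Longrightarrow> (\<Sum>j\<in>J. k j - \<gamma> (\<omega> j)) = real N \<Longrightarrow> j \<in> J \<Longrightarrow> \<gamma> (\<omega> j) = k j"
proof (induction N arbitrary: \<gamma> j rule: less_induct)
  case (less N)
  have Jn: "l \<in> {1..n}" "l \<noteq> i" if "l \<in> J" for l
    using J that by (auto simp: orthogonal_block_def)
  have fin: "finite J"
    by (rule finite_subset[of J "{1..n}"]) (use Jn in auto)
  have defect: "\<exists>d::nat. k l - \<delta> (\<omega> l) = real d" if "l \<in> J" "\<delta> \<in> active i" for l and \<delta> :: "'a \<Rightarrow> real"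
    by (rule coeff_defect[of \<delta> l]) (use that Jn[OF that(1)] in \<open>auto simp: active_def\<close>)
  define d where "d l = k l - \<gamma> (\<omega> l)" for l
  \<comment> \<open>The vector dual to the block part of \<beta> - \<gamma>; the claim amounts to
    its vanishing.\<close>
  define D where "D = (\<Sum>l\<in>J. d l *\<^sub>R dual_vector (\<alpha> l))"
  have D_in: "D \<in> \<aa>"
    unfolding D_def by (intro subspace_sum[OF subspace_a] subspace_scale[OF subspace_a] dual_vector \<alpha>_root Jn)
  have D: "killing_form br D Y = (\<Sum>l\<in>J. d l * \<alpha> l Y)" if "Y \<in> \<aa>" for Y
  proof -
    have lin: "linear (\<lambda>x. killing_form br x Y)"
      by (rule linearI) (simp_all add: killing_add_left killing_scale_left)
    have "killing_form br D Y = (\<Sum>l\<in>J. killing_form br (d l *\<^sub>R dual_vector (\<alpha> l)) Y)"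
      unfolding D_def by (rule linear_sum[OF lin])
    also have "\<dots> = (\<Sum>l\<in>J. d l * \<alpha> l Y)"
      by (intro sum.cong refl) (simp add: killing_scale_left dual_vector[OF \<alpha>_root[OF Jn(1)]] that)
    finally show ?thesis .
  qed
  have "D = 0"
  proof (rule ccontr)
    assume "D \<noteq> 0"
    have "killing_form br D D = (\<Sum>j\<in>J. d j * killing_form br D (dual_vector (\<alpha> j)))"
      unfolding D[OF D_in]
      by (intro sum.cong refl) (simp add: killing_commute[of D] dual_vector[OF \<alpha>_root[OF Jn(1)]] D_in)
    also have "\<dots> = (\<Sum>j\<in>J. - (d j * \<gamma> (dual_vector (\<alpha> j))))"
      by (intro sum.cong refl)
        (simp add: D dual_vector[OF \<alpha>_root[OF Jn(1)]] active_dual_vector[OF i J less.prems(1)] flip: d_def)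
    finally have "(\<Sum>j\<in>J. - (d j * \<gamma> (dual_vector (\<alpha> j)))) > 0"
      using killing_pos[OF D_in \<open>D \<noteq> 0\<close>] by simp
    \<comment> \<open>A positive sum has a positive term; as defects are nonnegative, \<gamma> pairs
      negatively with this \<open>\<alpha> j\<close>.\<close>
    then obtain j where j: "j \<in> J" "- (d j * \<gamma> (dual_vector (\<alpha> j))) > 0"
      by (metis (no_types, lifting) not_le sum_nonpos)
    have "d j \<ge> 0"
      using defect[OF j(1) less.prems(1)] by (auto simp: d_def)
    then have neg: "\<gamma> (dual_vector (\<alpha> j)) < 0"
      using j(2) by (simp add: mult_less_0_iff)
    note \<alpha>j = \<alpha>_root[OF Jn(1)[OF j(1)]]
    have \<gamma>: "\<gamma> \<in> \<Sigma>"
      using less.prems(1) by (simp add: active_def unmultipliable_root)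
    define c where "c = \<gamma> (coroot (\<alpha> j))"
    have c: "c < 0"
      using neg root_dual_vector_pos[OF \<alpha>j] by (simp add: c_def root_coroot[OF \<gamma> \<alpha>j] divide_neg_pos)
    define \<gamma>' where "\<gamma>' = reflect (\<alpha> j) \<gamma>"
    have \<gamma>': "\<gamma>' \<in> active i"
      unfolding \<gamma>'_def by (rule reflect_active[OF less.prems(1) i Jn[OF j(1)]])
    have coeff: "\<gamma>' (\<omega> l) = \<gamma> (\<omega> l) - (if l = j then c else 0)" if "l \<in> J" for l
      using Jn(1)[OF j(1)] Jn(1)[OF that] by (simp add: \<gamma>'_def reflect_def c_def \<alpha>_\<omega>)
    obtain N' where N': "(\<Sum>l\<in>J. k l - \<gamma>' (\<omega> l)) = real N'"
    proof -
      obtain e :: "nat \<Rightarrow> nat" where "\<And>l. l \<in> J \<Longrightarrow> k l - \<gamma>' (\<omega> l) = real (e l)"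
        using defect[OF _ \<gamma>'] by metis
      then show thesis
        using that[of "\<Sum>l\<in>J. e l"] by simp
    qed
    have "(\<Sum>l\<in>J. k l - \<gamma>' (\<omega> l)) = (\<Sum>l\<in>J. (k l - \<gamma> (\<omega> l)) + (if l = j then c else 0))"
      by (intro sum.cong refl) (simp add: coeff)
    also have "\<dots> = real N + c"
      using less.prems(2) j(1) fin by (simp add: sum.distrib)
    finally have "N' < N"
      using N' c by simp
    then have "\<gamma>' (\<omega> l) = k l" if "l \<in> J" for l
      using less.IH[OF _ \<gamma>' N' that] by blast
    \<comment> \<open>By induction \<open>\<gamma>'\<close> has no defect on the block, hence is
      orthogonal to \<open>\<alpha> j\<close>; but the reflection only changed the sign of that
      negative pairing.\<close>
    then have "\<gamma>' (dual_vector (\<alpha> j)) = 0"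
      using active_dual_vector[OF i J \<gamma>' j(1)] by simp
    moreover have "\<gamma>' (dual_vector (\<alpha> j)) = - \<gamma> (dual_vector (\<alpha> j))"
      using root_dual_vector_pos[OF \<alpha>j] by (simp add: \<gamma>'_def reflect_def root_coroot[OF \<gamma> \<alpha>j])
    ultimately show False
      using neg by simp
  qed
  have "0 = killing_form br D (\<omega> j)"
    using \<open>D = 0\<close> killing_scale_left[of 0 0 "\<omega> j"] by simp
  also have "\<dots> = (\<Sum>l\<in>J. if l = j then d l else 0)"
    unfolding D[OF \<omega>_in_a[OF Jn(1)[OF less.prems(3)]]]
    by (intro sum.cong refl) (use Jn less.prems(3) in \<open>auto simp: \<alpha>_\<omega>\<close>)
  also have "\<dots> = d j"
    using less.prems(3) fin by simp
  finally show ?case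
    by (simp add: d_def)
qed

text \<open>A short segment centred at the point stays in the polyhedron: active roots and their
  negatives are constant along it, and all other roots have room to vary.\<close>

lemma vertex_not_extreme:
  assumes i: "i \<in> {1..n}" and J: "orthogonal_block i J" "J \<noteq> {}"
  shows "(1 / of_int (k i)) *\<^sub>R \<omega> i \<notin> extreme_boundary (Omega br \<aa>)"
proof
  let ?x = "(1 / of_int (k i)) *\<^sub>R \<omega> i"
  assume extreme: "?x \<in> extreme_boundary (Omega br \<aa>)"
  obtain j where j: "j \<in> J"
    using J by blast
  have jn: "j \<in> {1..n}" "j \<noteq> i"
    using J(1) j by (auto simp: orthogonal_block_def)
  have coeff: "\<gamma> (\<omega> j) = k j" if "\<gamma> \<in> active i" for \<gamma>
  proof -
    have "\<exists>d::nat. k l - \<gamma> (\<omega> l) = real d" if "l \<in> J" for l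
      by (rule coeff_defect[of \<gamma> l])
        (use \<open>\<gamma> \<in> active i\<close> J(1) that in \<open>auto simp: active_def orthogonal_block_def\<close>)
    then obtain e :: "nat \<Rightarrow> nat" where "\<And>l. l \<in> J \<Longrightarrow> k l - \<gamma> (\<omega> l) = real (e l)"
      by metis
    then have "(\<Sum>l\<in>J. k l - \<gamma> (\<omega> l)) = real (\<Sum>l\<in>J. e l)"
      by simp
    then show ?thesis
      using active_block_coeff[OF i J(1) that _ j] by blast
  qed
  \<comment> \<open>Active roots have coefficients \<open>k i\<close> and \<open>k j\<close> at i
    and j, so the two terms cancel.\<close>
  define v where "v = of_int (k i) *\<^sub>R \<omega> j - of_int (k j) *\<^sub>R \<omega> i"
  have vj: "of_int (k i) *\<^sub>R \<omega> j \<in> \<aa>" "of_int (k j) *\<^sub>R \<omega> i \<in> \<aa>"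
    using \<omega>_in_a i jn subspace_scale[OF subspace_a] by blast+
  have v: "v \<in> \<aa>"
    unfolding v_def using vj subspace_diff[OF subspace_a] by blast
  have \<gamma>v: "\<gamma> v = k i * \<gamma> (\<omega> j) - k j * \<gamma> (\<omega> i)" if "\<gamma> \<in> \<Sigma>" for \<gamma> :: "'a \<Rightarrow> real"
    unfolding v_def using vj \<omega>_in_a i jn that by (simp add: root_diff root_scale)
  have "\<alpha> j v = k i"
    using \<gamma>v[OF \<alpha>_root[OF jn(1)]] i jn by (simp add: \<alpha>_\<omega>)
  then have v0: "v \<noteq> 0"
    using k_ge_1[OF i] root_zero[OF \<alpha>_root[OF jn(1)]] by auto
  obtain K where K: "K > 0" "\<And>\<gamma> H. \<gamma> \<in> \<Sigma> \<Longrightarrow> H \<in> \<aa> \<Longrightarrow> \<bar>\<gamma> H\<bar> \<le> K * norm H"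
    using root_bounded by metis
  \<comment> \<open>As \<open>K * norm v\<close> bounds every root at \<open>v\<close>, the
    perturbation is at most 1 / \<open>k i\<close>, which integrality of the defects guarantees as a
    gap.\<close>
  define \<epsilon> where "\<epsilon> = 1 / (k i * K * norm v)"
  have ki: "real_of_int (k i) \<ge> 1"
    using k_ge_1[OF i] by simp
  have \<epsilon>: "\<epsilon> > 0"
    using ki K(1) v0 by (simp add: \<epsilon>_def)
  have x: "?x \<in> \<aa>"
    using \<omega>_in_a[OF i] subspace_scale[OF subspace_a] by blast
  have near: "?x + s *\<^sub>R v \<in> closure (Omega br \<aa>)" if s: "\<bar>s\<bar> = \<epsilon>" for s
  proof -
    have "\<bar>\<gamma> (?x + s *\<^sub>R v)\<bar> \<le> 1" if \<gamma>: "\<gamma> \<in> \<Sigma>l" for \<gamma>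
    proof -
      have \<gamma>\<Sigma>: "\<gamma> \<in> \<Sigma>"
        using \<gamma> by (rule unmultipliable_root)
      have val: "\<gamma> (?x + s *\<^sub>R v) = \<gamma> (\<omega> i) / k i + s * \<gamma> v"
        using x v subspace_scale[OF subspace_a v]
        by (simp add: root_add[OF \<gamma>\<Sigma>] root_scale[OF \<gamma>\<Sigma> v] vertex_value[OF \<gamma> i])
      obtain d :: nat where d: "\<gamma> (\<omega> i) = k i - real d"
        using coeff_defect[OF \<gamma> i] by blast
      obtain e :: nat where e: "- \<gamma> (\<omega> i) = k i - real e"
        using coeff_defect[OF uminus_unmultipliable_root[OF \<gamma>] i] by blast
      \<comment> \<open>Either \<gamma> is active, or its negative is, or its coefficient at i is at
        least one away from both extremes.\<close>
      consider "d = 0" | "e = 0" | "d \<ge> 1" "e \<ge> 1" by linarith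
      then show ?thesis
      proof cases
        case 1
        then have "\<gamma> \<in> active i"
          using d \<gamma> by (simp add: active_def)
        then have "\<gamma> v = 0"
          using \<gamma>v[OF \<gamma>\<Sigma>] coeff d 1 by simp
        then show ?thesis
          using val d 1 ki by simp
      next
        case 2
        then have "(\<lambda>Y. - \<gamma> Y) \<in> active i"
          using e uminus_unmultipliable_root[OF \<gamma>] by (simp add: active_def)
        then have "\<gamma> (\<omega> j) = - k j"
          using coeff[of "\<lambda>Y. - \<gamma> Y"] by simp
        moreover have "\<gamma> (\<omega> i) = - k i"
          using e 2 by simp
        ultimately have "\<gamma> v = 0"
          using \<gamma>v[OF \<gamma>\<Sigma>] by (simp add: algebra_simps)
        then show ?thesis
          using val \<open>\<gamma> (\<omega> i) = - k i\<close> ki by simp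
      next
        case 3
        have "\<bar>\<gamma> (\<omega> i)\<bar> \<le> k i - 1"
          using d e 3 by linarith
        then have 1: "\<bar>\<gamma> (\<omega> i) / k i\<bar> \<le> 1 - 1 / k i"
          using ki by (simp add: abs_divide field_simps)
        have "\<bar>s * \<gamma> v\<bar> \<le> \<epsilon> * (K * norm v)"
          unfolding abs_mult s using K(2)[OF \<gamma>\<Sigma> v] \<epsilon> by (intro mult_left_mono) auto
        also have "\<dots> = 1 / k i"
          using K(1) v0 ki by (simp add: \<epsilon>_def)
        finally show ?thesis
          using 1 unfolding val by linarith
      qed
    qed
    then show ?thesis
      using x v subspace_scale[OF subspace_a] subspace_add[OF subspace_a] by (auto simp: closure_Omega)
  qed
  let ?a = "?x + \<epsilon> *\<^sub>R v" and ?b = "?x + (- \<epsilon>) *\<^sub>R v"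
  have "?a \<noteq> ?b"
    using \<epsilon> v0 by (simp add: eq_neg_iff_add_eq_0 flip: scaleR_add_left)
  moreover have "midpoint ?a ?b = ?x"
    by (simp add: midpoint_def scaleR_2[symmetric])
  ultimately have "?x \<in> open_segment ?a ?b"
    using midpoint_in_open_segment[of ?a ?b] by simp
  then show False
    using extreme near[of \<epsilon>] near[of "- \<epsilon>"] \<epsilon>
    by (auto simp: extreme_boundary_def extreme_point_of_def)
qed

section \<open>Bonds of the affine diagram and its cuts\<close>

lemma affine_bond_iff:
  assumes "j \<in> {1..n}"
  shows "bond_number br \<aa> (\<lambda>Y. 1 - \<beta> Y) (\<alpha> j) \<noteq> 0 \<longleftrightarrow> \<beta> (dual_vector (\<alpha> j)) \<noteq> 0"
proof -
  \<comment> \<open>The affine node enters through - \<beta>; the sign does not affect vanishing,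
    and the two Cartan numbers vanish together by symmetry of the pairing.\<close>
  have lin: "linear_part (\<lambda>Y. 1 - \<beta> Y) = (\<lambda>Y. - \<beta> Y)" "linear_part (\<alpha> j) = \<alpha> j"
    using root_zero[OF \<beta>_root] root_zero[OF \<alpha>_root[OF assms]] by (simp_all add: linear_part_def)
  note roots = root_uminus[OF \<beta>_root] \<alpha>_root[OF assms]
  show ?thesis
    unfolding bond_number_def lin mult_eq_0_iff de_Morgan_disj
      cartan_number_nonzero_iff[OF roots] cartan_number_nonzero_iff[OF roots(2,1)]
      root_dual_vector_commute[OF roots(2,1)] by simp
qed

lemma simple_bond_iff:
  assumes "l \<in> {1..n}" "j \<in> {1..n}"
  shows "bond_number br \<aa> (\<alpha> l) (\<alpha> j) \<noteq> 0 \<longleftrightarrow> \<alpha> l (dual_vector (\<alpha> j)) \<noteq> 0"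
proof -
  have lin: "linear_part (\<alpha> l) = \<alpha> l" "linear_part (\<alpha> j) = \<alpha> j"
    using root_zero[OF \<alpha>_root] assms by (simp_all add: linear_part_def)
  note roots = \<alpha>_root[OF assms(1)] \<alpha>_root[OF assms(2)]
  show ?thesis
    unfolding bond_number_def lin mult_eq_0_iff de_Morgan_disj
      cartan_number_nonzero_iff[OF roots] cartan_number_nonzero_iff[OF roots(2,1)]
      root_dual_vector_commute[OF roots(2,1)] by simp
qed

lemma bond_number_commute: "bond_number br \<aa> f g = bond_number br \<aa> g f"
  by (simp add: bond_number_def mult.commute)

lemma inj_\<alpha>: "inj_on \<alpha> {1..n}"
proof (rule inj_onI)
  fix l j assume "l \<in> {1..n}" "j \<in> {1..n}" "\<alpha> l = \<alpha> j"
  then show "l = j"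
    using \<alpha>_\<omega>[of l l] \<alpha>_\<omega>[of l j] by (auto split: if_splits)
qed

lemma \<alpha>0_neq: "j \<in> {1..n} \<Longrightarrow> (\<lambda>Y. 1 - \<beta> Y) \<noteq> \<alpha> j"
  using root_zero[OF \<beta>_root] root_zero[OF \<alpha>_root[of j]] by (auto dest: fun_cong[of _ _ 0])

text \<open>Sets of nodes containing the affine node and closed under adjacency are exactly the
  complements of the images of orthogonal blocks.\<close>

lemma connected_iff_no_block:
  assumes i: "i \<in> {1..n}"
  shows "Digraph_Component.connected
      (pre_digraph.del_vert (with_proj (affine_dynkin_diagram br \<aa> n \<alpha> \<beta>)) (\<alpha> i)) \<longleftrightarrow>
    (\<forall>J. orthogonal_block i J \<longrightarrow> J = {})"
proof -
  define G where "G = pre_digraph.del_vert (with_proj (affine_dynkin_diagram br \<aa> n \<alpha> \<beta>)) (\<alpha> i)"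
  define \<alpha>0 where "\<alpha>0 = (\<lambda>Y. 1 - \<beta> Y)"
  define I where "I = {1..n} - {i}"
  have \<alpha>0: "\<alpha>0 \<noteq> \<alpha> j" if "j \<in> {1..n}" for j
    using \<alpha>0_neq[OF that] by (simp add: \<alpha>0_def)
  have verts: "verts G = insert \<alpha>0 (\<alpha> ` I)"
  proof -
    have "verts G = insert \<alpha>0 (\<alpha> ` {1..n}) - {\<alpha> i}"
      by (simp add: G_def \<alpha>0_def affine_dynkin_diagram_def affine_simple_roots_def
          pre_digraph.del_vert_def)
    also have "\<dots> = insert \<alpha>0 (\<alpha> ` {1..n} - \<alpha> ` {i})"
      using \<alpha>0[OF i] by auto
    also have "\<alpha> ` {1..n} - \<alpha> ` {i} = \<alpha> ` I"
      unfolding I_def by (rule inj_on_image_set_diff[OF inj_\<alpha>, symmetric]) (use i in auto)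
    finally show ?thesis .
  qed
  have arcs: "arcs G = {(f, g). f \<in> verts G \<and> g \<in> verts G \<and> f \<noteq> g \<and> bond_number br \<aa> f g \<noteq> 0}"
    by (auto simp: G_def affine_dynkin_diagram_def pre_digraph.del_vert_def)
  have ends: "tail G = fst" "head G = snd"
    by (simp_all add: G_def pre_digraph.del_vert_def)
  have wf: "wf_digraph G"
    by (auto simp: wf_digraph_def arcs ends)
  have bonds: "bond_number br \<aa> \<alpha>0 (\<alpha> j) \<noteq> 0 \<longleftrightarrow> \<beta> (dual_vector (\<alpha> j)) \<noteq> 0"
    "bond_number br \<aa> (\<alpha> l) (\<alpha> j) \<noteq> 0 \<longleftrightarrow> \<alpha> l (dual_vector (\<alpha> j)) \<noteq> 0" if "l \<in> I" "j \<in> I" for l j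
    using that affine_bond_iff simple_bond_iff by (auto simp: \<alpha>0_def I_def)
  have "Digraph_Component.connected G \<longleftrightarrow>
    (\<forall>C \<subseteq> verts G. \<alpha>0 \<in> C \<and> (\<forall>e\<in>arcs G. tail G e \<in> C \<longleftrightarrow> head G e \<in> C) \<longrightarrow> C = verts G)"
    by (rule connected_iff_no_cut[OF wf]) (simp add: verts)
  also have "\<dots> \<longleftrightarrow> (\<forall>J. orthogonal_block i J \<longrightarrow> J = {})"
  proof (intro iffI allI impI)
    fix J
    assume no_cut: "\<forall>C \<subseteq> verts G. \<alpha>0 \<in> C \<and> (\<forall>e\<in>arcs G. tail G e \<in> C \<longleftrightarrow> head G e \<in> C) \<longrightarrow> C = verts G"
      and J: "orthogonal_block i J"
    have JI: "J \<subseteq> I"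
      using J by (auto simp: orthogonal_block_def I_def)
    define C where "C = verts G - \<alpha> ` J"
    have C: "C = insert \<alpha>0 (\<alpha> ` (I - J))"
    proof -
      have "inj_on \<alpha> I"
        by (rule inj_on_subset[OF inj_\<alpha>]) (simp add: I_def)
      moreover have "\<alpha>0 \<notin> \<alpha> ` J"
        using JI \<alpha>0 unfolding I_def by blast
      ultimately show ?thesis
        using inj_on_image_set_diff[of \<alpha> I I J] JI by (auto simp: C_def verts)
    qed
    have no_bond: "bond_number br \<aa> f (\<alpha> j) = 0" if f: "f \<in> C" and j: "j \<in> J" for f j
    proof -
      have "j \<in> I" using j JI by blast
      consider "f = \<alpha>0" | l where "f = \<alpha> l" "l \<in> I - J"
        using f C by blast
      then show ?thesis
      proof cases
        case 1
        then show ?thesis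
          using bonds(1)[OF \<open>j \<in> I\<close> \<open>j \<in> I\<close>] J j by (auto simp: orthogonal_block_def)
      next
        case (2 l)
        then show ?thesis
          using bonds(2)[of l j] \<open>j \<in> I\<close> J j by (auto simp: orthogonal_block_def I_def)
      qed
    qed
    have "f \<in> C \<longleftrightarrow> g \<in> C" if e: "(f, g) \<in> arcs G" for f g
    proof -
      have fg: "f \<in> verts G" "g \<in> verts G" "bond_number br \<aa> f g \<noteq> 0" "bond_number br \<aa> g f \<noteq> 0"
        using e bond_number_commute[of g f] by (auto simp: arcs)
      show ?thesis
        using no_bond fg by (auto simp: C_def)
    qed
    then have "\<forall>e\<in>arcs G. tail G e \<in> C \<longleftrightarrow> head G e \<in> C"
      by (auto simp: ends)
    moreover have "C \<subseteq> verts G" "\<alpha>0 \<in> C"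
      by (simp add: C_def) (simp add: C)
    ultimately have "C = verts G"
      using no_cut by blast
    then have "\<alpha> ` J \<inter> verts G = {}"
      by (auto simp: C_def)
    then show "J = {}"
      using JI by (auto simp: verts)
  next
    fix C
    assume no_block: "\<forall>J. orthogonal_block i J \<longrightarrow> J = {}" and CV: "C \<subseteq> verts G"
      and C: "\<alpha>0 \<in> C \<and> (\<forall>e\<in>arcs G. tail G e \<in> C \<longleftrightarrow> head G e \<in> C)"
    \<comment> \<open>The simple nodes missed by the cut; no arc leaves \<open>C\<close>, so they
      are orthogonal to everything inside it.\<close>
    define J where "J = {j \<in> I. \<alpha> j \<notin> C}"
    have no_bond: "bond_number br \<aa> f (\<alpha> j) = 0" if "f \<in> C" "j \<in> J" for f j
    proof (rule ccontr)
      assume "bond_number br \<aa> f (\<alpha> j) \<noteq> 0"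
      then have "(f, \<alpha> j) \<in> arcs G"
        using that CV by (auto simp: arcs J_def verts)
      then show False
        using C that by (force simp: ends J_def)
    qed
    have "orthogonal_block i J"
      unfolding orthogonal_block_def
    proof (intro conjI ballI)
      show "J \<subseteq> {1..n} - {i}"
        by (auto simp: J_def I_def)
      show "\<beta> (dual_vector (\<alpha> j)) = 0" if "j \<in> J" for j
        using no_bond[of \<alpha>0 j] bonds(1)[of j j] that C by (auto simp: J_def)
      show "\<alpha> l (dual_vector (\<alpha> j)) = 0" if "j \<in> J" "l \<in> {1..n} - {i} - J" for j l
        using no_bond[of "\<alpha> l" j] bonds(2)[of l j] that by (auto simp: J_def I_def)
    qed
    then have "J = {}"
      using no_block by blast
    then show "C = verts G"
      using C CV by (auto simp: J_def verts)
  qed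
  finally show ?thesis
    unfolding G_def .
qed

end

theorem theorem2p6:
  fixes br :: "'g::euclidean_space \<Rightarrow> 'g \<Rightarrow> 'g"
    and \<kk> \<pp> \<aa> :: "'g set"
    and n :: nat
    and \<alpha> :: "nat \<Rightarrow> 'g \<Rightarrow> real"
    and \<beta> :: "'g \<Rightarrow> real"
    and k :: "nat \<Rightarrow> int"
    and \<omega> :: "nat \<Rightarrow> 'g"
  assumes "simple_lie_algebra br"
    and "\<not> compact_lie_algebra br"
    and "cartan_decomposition br \<kk> \<pp>"
    and "maximal_abelian_in br \<pp> \<aa>"
    and "root_basis \<aa> (unmultipliable_roots (restricted_roots br \<aa>)) n \<alpha>"
    and "highest_root (unmultipliable_roots (restricted_roots br \<aa>)) n \<alpha> \<beta>"
    and "\<And>Y. \<beta> Y = (\<Sum>i=1..n. of_int (k i) * \<alpha> i Y)"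
    and "\<And>i. i \<in> {1..n} \<Longrightarrow> \<omega> i \<in> \<aa>"
    and "\<And>i j. i \<in> {1..n} \<Longrightarrow> j \<in> {1..n} \<Longrightarrow> \<alpha> j (\<omega> i) = (if i = j then 1 else 0)"
  shows "\<forall>i\<in>{1..n}.
    (1 / of_int (k i)) *\<^sub>R \<omega> i \<in> extreme_boundary (Omega br \<aa>) \<longleftrightarrow>
    Digraph_Component.connected
      (pre_digraph.del_vert (with_proj (affine_dynkin_diagram br \<aa> n \<alpha> \<beta>)) (\<alpha> i))"
proof -
  interpret lie_algebra br
    using assms(1) by (rule simple_lie_algebra.axioms)
  interpret highest_root_setting br \<kk> \<pp> \<aa> n \<alpha> \<beta> k \<omega>
    by unfold_locales (use assms in auto)
  show ?thesis
    \<comment> \<open>Both properties amount to the absence of a nonempty orthogonal block.\<close>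
    using vertex_extreme vertex_not_extreme connected_iff_no_block by blast
qed

end
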